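(* Let $H$ be a Hopf algebra with bijective antipode over a field $k$, let $C$ be a right $H$-module coalgebra, $B=C/CH^+$, and let $\tau$ be a twisting of $C$ which is invertible in the algebra $(\mathrm{Hom}(C,H\otimes C),\ast)$. Then $C^\tau/B$ is an $H$-Galois coextension if and only if $C/B$ is an $H$-Galois coextension.
   Context: All maps are $k$-linear; $\Delta(c)=c_1\otimes c_2$ (Sweedler notation, summation understood). A right $H$-module coalgebra is a coalgebra $C$ that is a right $H$-module with $\Delta(c\cdot h)=c_1\cdot h_1\otimes c_2\cdot h_2$ and $\varepsilon_C(c\cdot h)=\varepsilon_C(c)\varepsilon_H(h)$. Twistings. $\mathrm{Hom}(C,H\otimes C)$ is an algebra with product $\tau\ast\lambda=(m_H\otimes id_C)\circ(id_H\otimes\lambda)\circ\tau$ and unit $\sigma(c)=1\otimes c$. Write $\tau(c)=c_{-1}\otimes c_0$. Suppose $\tau$ is normalized: $c_{-1}\varepsilon_C(c_0)=\varepsilon_C(c)1_H$ and $\varepsilon_H(c_{-1})c_0=c$. Let $C^\tau$ be $C$ as a right $H$-module, with comultiplication $\Delta_\tau(c)=c_1\cdot c_{2.-1}\otimes c_{2.0}$, where $\tau(c_2)=c_{2.-1}\otimes c_{2.0}$ (counit $\varepsilon_C$). $\mathcal M_H^C$ is the category of right $H$-modules and right $C$-comodules $M$ with $\rho(m\cdot h)=m_0\cdot h_1\otimes m_1\cdot h_2$; for such $M$, $M^\tau$ is $M$ as an $H$-module with $\rho^\tau(m)=m_0\cdot m_{1.-1}\otimes m_{1.0}$. A normalized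 $\tau$ is called a twisting of $C$ if $C^\tau$ is a right $H$-module coalgebra and $M^\tau\in\mathcal M_H^{C^\tau}$ for all $M\in\mathcal M_H^C$. It is known that a normalized $\tau$ is a twisting if and only if, for all $c\in C,h\in H$: $c_{-1}h_1\otimes c_0\cdot h_2=h_1(c\cdot h_2)_{-1}\otimes(c\cdot h_2)_0$ and $c_{-1}\otimes c_{0.1}\cdot c_{0.2.-1}\otimes c_{0.2.0}=c_{1.-1}c_{2.-1.1}\otimes c_{1.0}\cdot c_{2.-1.2}\otimes c_{2.0}$ (a final numerical index $.1$ or $.2$ denotes a component of the original comultiplication of $C$ or of $H$). Galois coextensions. $H^+=\ker\varepsilon_H$, so $CH^+$ is spanned by the elements $c\cdot(h-\varepsilon(h)1)$, and $B=C/CH^+$ is a quotient coalgebra of $C$; for a twisting $\tau$ one has $C^\tau/C^\tau H^+=B$ as well. For a right $H$-module coalgebra $D$ with quotient coalgebra $\pi:D\to B=D/DH^+$, $D$ is a $B$-bicomodule via $(\pi\otimes id)\Delta_D$ and $(id\otimes\pi)\Delta_D$, and $D/B$ is called an $H$-Galois coextension if the canonical map $D\otimes H\to D\,\Box_B D$, $d\otimes h\mapsto d_1\otimes d_2\cdot h$ (with $d_1\otimes d_2=\Delta_D(d)$ and $\Box_B$ the cotensor product) is bijective. For $D=C^\tau$ this map is $c\otimes h\mapsto c_1\cdot c_{2.-1}h_1'\otimes c_{2.0}\cdot h_2'$ with $h_1'\otimes h_2'=1\otimes h$, i.e. $c\otimes h\mapsto c_1\cdot c_{2.-1}\otimes c_{2.0}\cdot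 h$. *)

theory Defs
  imports "HOL.Vector_Spaces" "HOL-Library.Poly_Mapping"
begin

section \<open>Quotients and tensor products of vector spaces\<close>

text \<open>
  A vector space over the field \<open>'k\<close> is a type of class \<open>ab_group_add\<close> with a scalar
  multiplication satisfying \<^locale>\<open>vector_space\<close>. The quotient \<open>V/N\<close> by a subspace \<open>N\<close> is
  realized as a complement of \<open>N\<close>: \<open>quot_map s N\<close> is a linear idempotent with kernel exactly
  \<open>N\<close>, so it is the quotient map \<open>V \<rightarrow> V/N\<close>, with \<open>V/N\<close> realized as its range (it exists, see
  \<open>quot_map_props\<close>). In contrast to the set of cosets, \<open>V/N\<close> then again lives in a type of
  class \<open>ab_group_add\<close>, so that these constructions can be iterated.
\<close>

definition quot_map :: "('k::field \<Rightarrow> 'v::ab_group_add \<Rightarrow> 'v) \<Rightarrow> 'v set \<Rightarrow> 'v \<Rightarrow> 'v" where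
  "quot_map s N = (SOME p. Vector_Spaces.linear s s p \<and> (\<forall>x. p (p x) = p x) \<and> {x. p x = 0} = N)"

lemma quot_map_props:
  assumes "vector_space s" and "module.subspace s N"
  shows "Vector_Spaces.linear s s (quot_map s N)"
    and "quot_map s N (quot_map s N x) = quot_map s N x"
    and "quot_map s N x = 0 \<longleftrightarrow> x \<in> N"
proof -
  interpret vector_space s by fact
  interpret vp: vector_space_pair s s by unfold_locales
  obtain A where A: "A \<subseteq> N" "independent A" "N \<subseteq> span A"
    by (rule basis_exists)
  have spA: "span A = N"
    using span_minimal[OF A(1) assms(2)] A(3) by (rule subset_antisym)
  define E where "E = extend_basis A"
  have E: "independent E" "A \<subseteq> E" "span E = UNIV"
    using A(2) by (simp_all add: E_def independent_extend_basis extend_basis_superset)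
  define p where "p = vp.construct E (\<lambda>b. if b \<in> A then 0 else b)"
  have lin: "Vector_Spaces.linear s s p"
    unfolding p_def by (rule vp.linear_construct) (rule E)
  interpret p: Vector_Spaces.linear s s p by (rule lin)
  have pb: "p b = (if b \<in> A then 0 else b)" if "b \<in> E" for b
    unfolding p_def using vp.construct_basis[OF E(1) that] .
  have diff: "x - p x \<in> N" for x
  proof -
    have "x \<in> span E" using E by simp
    then show ?thesis
    proof (induction rule: span_induct_alt)
      case base
      then show ?case using assms(2) by (simp add: subspace_0)
    next
      case (step c b y)
      have "b - p b \<in> N"
        using pb[OF step(1)] A(1) assms(2) by (auto simp: subspace_0)
      then have "s c (b - p b) + (y - p y) \<in> N"
        using assms(2) step(2) by (intro subspace_add subspace_scale)
      moreover have "s c (b - p b) + (y - p y) = (s c b + y) - p (s c b + y)"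
        by (simp add: p.add p.scale scale_right_diff_distrib)
      ultimately show ?case by simp
    qed
  qed
  have ker: "p x = 0" if "x \<in> N" for x
  proof -
    have "x \<in> span A" using that spA by simp
    then show ?thesis
      by (induction rule: span_induct_alt) (use pb E(2) in \<open>auto simp: p.add p.scale\<close>)
  qed
  have "p (p x) = p x" for x
    using ker[OF diff[of x]] by (simp add: p.diff)
  moreover have "p x = 0 \<longleftrightarrow> x \<in> N" for x
    using ker[of x] diff[of x] by auto
  then have "{x. p x = 0} = N" by simp
  ultimately have ex: "\<exists>p. Vector_Spaces.linear s s p \<and> (\<forall>x. p (p x) = p x) \<and> {x. p x = 0} = N"
    using lin by blast
  note * = someI_ex[OF ex, folded quot_map_def]
  show "Vector_Spaces.linear s s (quot_map s N)" using * by blast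
  show "quot_map s N (quot_map s N x) = quot_map s N x" using * by blast
  show "quot_map s N x = 0 \<longleftrightarrow> x \<in> N" using * by blast
qed

definition bilinear_map ::
    "('k::field \<Rightarrow> 'v::ab_group_add \<Rightarrow> 'v) \<Rightarrow> ('k \<Rightarrow> 'w::ab_group_add \<Rightarrow> 'w) \<Rightarrow>
     ('k \<Rightarrow> 'x::ab_group_add \<Rightarrow> 'x) \<Rightarrow> ('v \<Rightarrow> 'w \<Rightarrow> 'x) \<Rightarrow> bool" where
  "bilinear_map sV sW sX \<beta> \<longleftrightarrow>
     (\<forall>v. Vector_Spaces.linear sW sX (\<beta> v)) \<and> (\<forall>w. Vector_Spaces.linear sV sX (\<lambda>v. \<beta> v w))"

definition fscale :: "'k::field \<Rightarrow> ('x \<Rightarrow>\<^sub>0 'k) \<Rightarrow> ('x \<Rightarrow>\<^sub>0 'k)" where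
  "fscale a f = Poly_Mapping.map ((*) a) f"

lemma lookup_fscale [simp]: "Poly_Mapping.lookup (fscale a f) x = a * Poly_Mapping.lookup f x"
  by (simp add: fscale_def Poly_Mapping.map.rep_eq when_def)

lemma vector_space_fscale: "vector_space fscale"
  by unfold_locales (auto intro!: poly_mapping_eqI simp: lookup_add algebra_simps)

text \<open>
  \<open>V \<otimes> W\<close> is the free vector space on \<open>V \<times> W\<close> modulo the bilinearity relations. Scalar
  multiplication on every tensor product is \<^const>\<open>fscale\<close>. Tensor products of subspaces
  \<open>A \<subseteq> V\<close>, \<open>B \<subseteq> W\<close> are identified with their (injective, as \<open>'k\<close> is a field) image
  \<open>tensor_space sV sW A B\<close> in \<open>V \<otimes> W\<close>. Threefold tensor products are bracketed to the right.
\<close>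

definition tensor_rels ::
    "('k::field \<Rightarrow> 'v::ab_group_add \<Rightarrow> 'v) \<Rightarrow> ('k \<Rightarrow> 'w::ab_group_add \<Rightarrow> 'w) \<Rightarrow>
     ('v \<times> 'w \<Rightarrow>\<^sub>0 'k) set" where
  "tensor_rels sV sW =
     {Poly_Mapping.single (v + v', w) 1 - Poly_Mapping.single (v, w) 1
        - Poly_Mapping.single (v', w) 1 | v v' w. True}
   \<union> {Poly_Mapping.single (v, w + w') 1 - Poly_Mapping.single (v, w) 1
        - Poly_Mapping.single (v, w') 1 | v w w'. True}
   \<union> {Poly_Mapping.single (sV a v, w) 1 - fscale a (Poly_Mapping.single (v, w) 1) | a v w. True}
   \<union> {Poly_Mapping.single (v, sW a w) 1 - fscale a (Poly_Mapping.single (v, w) 1) | a v w. True}"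

definition tensor ::
    "'v \<Rightarrow> ('k::field \<Rightarrow> 'v::ab_group_add \<Rightarrow> 'v) \<Rightarrow> ('k \<Rightarrow> 'w::ab_group_add \<Rightarrow> 'w) \<Rightarrow> 'w \<Rightarrow>
     ('v \<times> 'w \<Rightarrow>\<^sub>0 'k)"  ("_ \<otimes>\<^bsub>_,_\<^esub> _" [71, 0, 0, 70] 70) where
  "v \<otimes>\<^bsub>sV,sW\<^esub> w =
     quot_map fscale (module.span fscale (tensor_rels sV sW)) (Poly_Mapping.single (v, w) 1)"

definition tensor_space ::
    "('k::field \<Rightarrow> 'v::ab_group_add \<Rightarrow> 'v) \<Rightarrow> ('k \<Rightarrow> 'w::ab_group_add \<Rightarrow> 'w) \<Rightarrow>
     'v set \<Rightarrow> 'w set \<Rightarrow> ('v \<times> 'w \<Rightarrow>\<^sub>0 'k) set" where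
  "tensor_space sV sW A B = module.span fscale {v \<otimes>\<^bsub>sV,sW\<^esub> w | v w. v \<in> A \<and> w \<in> B}"

text \<open>
  \<open>tlift sX \<beta> t\<close> is the value at \<open>t \<in> V \<otimes> W\<close> of the linear map \<open>V \<otimes> W \<rightarrow> X\<close> induced by the
  bilinear map \<open>\<beta>\<close> (see \<open>tlift_tensor\<close>, \<open>linear_tlift\<close>). It renders Sweedler notation: with
  \<open>\<Delta>(c) = c\<^sub>1 \<otimes> c\<^sub>2\<close>, the expression \<open>tlift sX (\<lambda>c1 c2. e c1 c2) (\<Delta> c)\<close> is \<open>e(c\<^sub>1, c\<^sub>2)\<close>.
\<close>

definition tlift ::
    "('k::field \<Rightarrow> 'x::ab_group_add \<Rightarrow> 'x) \<Rightarrow> ('v \<Rightarrow> 'w \<Rightarrow> 'x) \<Rightarrow> ('v \<times> 'w \<Rightarrow>\<^sub>0 'k) \<Rightarrow> 'x" where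
  "tlift sX \<beta> t =
     (\<Sum>(v, w)\<in>Poly_Mapping.keys t. sX (Poly_Mapping.lookup t (v, w)) (\<beta> v w))"

lemma linear_tlift:
  fixes \<beta> :: "'c \<Rightarrow> 'd \<Rightarrow> 'x::ab_group_add" and sX :: "'a::field \<Rightarrow> 'x \<Rightarrow> 'x"
  assumes "vector_space sX"
  shows "Vector_Spaces.linear fscale sX (tlift sX \<beta>)"
proof -
  interpret vector_space sX by fact
  interpret F: vector_space fscale by (rule vector_space_fscale)
  have sup: "tlift sX \<beta> t = (\<Sum>(v, w)\<in>K. sX (Poly_Mapping.lookup t (v, w)) (\<beta> v w))"
    if "finite K" "Poly_Mapping.keys t \<subseteq> K" for t K
    unfolding tlift_def using that
    by (intro sum.mono_neutral_left) (auto simp: in_keys_iff)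
  show ?thesis
  proof unfold_locales
    fix t u :: "'c \<times> 'd \<Rightarrow>\<^sub>0 'a"
    let ?K = "Poly_Mapping.keys t \<union> Poly_Mapping.keys u"
    show "tlift sX \<beta> (t + u) = tlift sX \<beta> t + tlift sX \<beta> u"
      using sup[of ?K t] sup[of ?K u] sup[of ?K "t + u"] keys_add[of t u]
      by (simp add: sum.distrib[symmetric] lookup_add scale_left_distrib split_beta)
  next
    fix a and t :: "'c \<times> 'd \<Rightarrow>\<^sub>0 'a"
    show "tlift sX \<beta> (fscale a t) = sX a (tlift sX \<beta> t)"
    proof -
      have "Poly_Mapping.keys (fscale a t) \<subseteq> Poly_Mapping.keys t"
        by (auto simp: in_keys_iff)
      then show ?thesis
        using sup[of "Poly_Mapping.keys t" t] sup[of "Poly_Mapping.keys t" "fscale a t"]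
        by (simp add: scale_sum_right split_beta)
    qed
  qed
qed

lemma tlift_tensor:
  assumes "bilinear_map sV sW sX \<beta>"
  shows "tlift sX \<beta> (v \<otimes>\<^bsub>sV,sW\<^esub> w) = \<beta> v w"
proof -
  have l1: "Vector_Spaces.linear sW sX (\<beta> v)" and l2: "Vector_Spaces.linear sV sX (\<lambda>v. \<beta> v w)"
    for v w using assms by (auto simp: bilinear_map_def)
  interpret X: vector_space sX using l1[of undefined] by (simp add: Vector_Spaces.linear_def)
  interpret F: vector_space fscale by (rule vector_space_fscale)
  interpret L: Vector_Spaces.linear fscale sX "tlift sX \<beta>"
    by (rule linear_tlift) unfold_locales
  have sc: "\<beta> v (sW a w) = sX a (\<beta> v w)" "\<beta> (sV a v) w = sX a (\<beta> v w)"
    "\<beta> v (w + w') = \<beta> v w + \<beta> v w'" "\<beta> (v + v') w = \<beta> v w + \<beta> v' w" for a v v' w w'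
    using l1[of v] l2[of w] by (simp_all add: Vector_Spaces.linear_iff)
  have s: "tlift sX \<beta> (Poly_Mapping.single (v, w) 1) = \<beta> v w" for v w
    by (simp add: tlift_def)
  let ?N = "F.span (tensor_rels sV sW)"
  have N: "tlift sX \<beta> t = 0" if "t \<in> ?N" for t
    using that
  proof (induction rule: F.span_induct_alt)
    case (step c r y)
    have "tlift sX \<beta> r = 0"
      using step(1) by (auto simp: tensor_rels_def L.diff L.scale s sc)
    then show ?case using step by (simp add: L.add L.scale)
  qed simp
  note q = quot_map_props[OF vector_space_fscale F.subspace_span[of "tensor_rels sV sW"]]
  let ?s = "Poly_Mapping.single (v, w) (1::'a)"
  interpret Q: Vector_Spaces.linear fscale fscale "quot_map fscale ?N" by (rule q(1))
  have "?s - quot_map fscale ?N ?s \<in> ?N"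
    using q(2,3) by (metis Q.diff diff_self)
  from N[OF this] show ?thesis
    by (simp add: L.diff s tensor_def)
qed

lemma bilinear_tensor:
  assumes "vector_space sV" and "vector_space sW"
  shows "bilinear_map sV sW fscale (\<lambda>v w. v \<otimes>\<^bsub>sV,sW\<^esub> w)"
proof -
  interpret V: vector_space sV by fact
  interpret W: vector_space sW by fact
  interpret F: vector_space fscale by (rule vector_space_fscale)
  let ?N = "F.span (tensor_rels sV sW)"
  note q = quot_map_props[OF vector_space_fscale F.subspace_span[of "tensor_rels sV sW"]]
  interpret Q: Vector_Spaces.linear fscale fscale "quot_map fscale ?N" by (rule q(1))
  have z: "quot_map fscale ?N r = 0" if "r \<in> tensor_rels sV sW" for r
    using q(3) F.span_base[OF that] by blast
  have "(v + v') \<otimes>\<^bsub>sV,sW\<^esub> w = (v \<otimes>\<^bsub>sV,sW\<^esub> w) + (v' \<otimes>\<^bsub>sV,sW\<^esub> w)" for v v' w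
  proof -
    have "Poly_Mapping.single (v + v', w) 1 - Poly_Mapping.single (v, w) 1
        - Poly_Mapping.single (v', w) 1 \<in> tensor_rels sV sW"
      unfolding tensor_rels_def by blast
    from z[OF this] show ?thesis by (simp add: tensor_def Q.diff Q.add diff_diff_eq)
  qed
  moreover have "v \<otimes>\<^bsub>sV,sW\<^esub> (w + w') = (v \<otimes>\<^bsub>sV,sW\<^esub> w) + (v \<otimes>\<^bsub>sV,sW\<^esub> w')" for v w w'
  proof -
    have "Poly_Mapping.single (v, w + w') 1 - Poly_Mapping.single (v, w) 1
        - Poly_Mapping.single (v, w') 1 \<in> tensor_rels sV sW"
      unfolding tensor_rels_def by blast
    from z[OF this] show ?thesis by (simp add: tensor_def Q.diff Q.add diff_diff_eq)
  qed
  moreover have "(sV a v) \<otimes>\<^bsub>sV,sW\<^esub> w = fscale a (v \<otimes>\<^bsub>sV,sW\<^esub> w)" for a v w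
  proof -
    have "Poly_Mapping.single (sV a v, w) 1 - fscale a (Poly_Mapping.single (v, w) 1)
        \<in> tensor_rels sV sW"
      unfolding tensor_rels_def by blast
    from z[OF this] show ?thesis by (simp add: tensor_def Q.diff Q.scale)
  qed
  moreover have "v \<otimes>\<^bsub>sV,sW\<^esub> (sW a w) = fscale a (v \<otimes>\<^bsub>sV,sW\<^esub> w)" for a v w
  proof -
    have "Poly_Mapping.single (v, sW a w) 1 - fscale a (Poly_Mapping.single (v, w) 1)
        \<in> tensor_rels sV sW"
      unfolding tensor_rels_def by blast
    from z[OF this] show ?thesis by (simp add: tensor_def Q.diff Q.scale)
  qed
  ultimately show ?thesis
    using assms vector_space_fscale by (simp add: bilinear_map_def Vector_Spaces.linear_iff)
qed


section \<open>Coalgebras, Hopf algebras, modules and comodules\<close>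

locale coalgebra = vector_space sC
  for sC :: "'k::field \<Rightarrow> 'c::ab_group_add \<Rightarrow> 'c" +
  fixes \<Delta> :: "'c \<Rightarrow> ('c \<times> 'c \<Rightarrow>\<^sub>0 'k)" and \<epsilon> :: "'c \<Rightarrow> 'k"
  assumes comult_linear: "Vector_Spaces.linear sC fscale \<Delta>"
    and comult_in: "\<Delta> c \<in> tensor_space sC sC UNIV UNIV"
    and counit_linear: "Vector_Spaces.linear sC (*) \<epsilon>"
    and coassoc:
      "tlift fscale (\<lambda>c1 c2. tlift fscale (\<lambda>c11 c12. c11 \<otimes>\<^bsub>sC,fscale\<^esub> (c12 \<otimes>\<^bsub>sC,sC\<^esub> c2)) (\<Delta> c1)) (\<Delta> c)
       = tlift fscale (\<lambda>c1 c2. c1 \<otimes>\<^bsub>sC,fscale\<^esub> \<Delta> c2) (\<Delta> c)"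
    and counit_left: "tlift sC (\<lambda>c1 c2. sC (\<epsilon> c1) c2) (\<Delta> c) = c"
    and counit_right: "tlift sC (\<lambda>c1 c2. sC (\<epsilon> c2) c1) (\<Delta> c) = c"

text \<open>The class \<open>ring_1\<close> requires \<open>1 \<noteq> 0\<close>, which holds in every Hopf algebra since \<open>\<epsilon>(1) = 1\<close>.\<close>

locale hopf_algebra = coalgebra sH \<Delta> \<epsilon>
  for sH :: "'k::field \<Rightarrow> 'h::ring_1 \<Rightarrow> 'h"
    and \<Delta> :: "'h \<Rightarrow> ('h \<times> 'h \<Rightarrow>\<^sub>0 'k)" and \<epsilon> :: "'h \<Rightarrow> 'k" +
  fixes S :: "'h \<Rightarrow> 'h"
  assumes mult_bilinear: "bilinear_map sH sH sH (*)"
    and comult_mult: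
      "\<Delta> (g * h) = tlift fscale (\<lambda>g1 g2. tlift fscale (\<lambda>h1 h2. (g1 * h1) \<otimes>\<^bsub>sH,sH\<^esub> (g2 * h2)) (\<Delta> h)) (\<Delta> g)"
    and comult_one: "\<Delta> 1 = 1 \<otimes>\<^bsub>sH,sH\<^esub> 1"
    and counit_mult: "\<epsilon> (g * h) = \<epsilon> g * \<epsilon> h"
    and counit_one: "\<epsilon> 1 = 1"
    and antipode_linear: "Vector_Spaces.linear sH sH S"
    and antipode_left: "tlift sH (\<lambda>h1 h2. S h1 * h2) (\<Delta> h) = sH (\<epsilon> h) 1"
    and antipode_right: "tlift sH (\<lambda>h1 h2. h1 * S h2) (\<Delta> h) = sH (\<epsilon> h) 1"

text \<open>
  Modules and comodules have a subspace \<open>M\<close> of an ambient vector space (with scalar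
  multiplication \<open>sM\<close>) as underlying space. Their structure maps are given as (bi)linear maps on
  the ambient space that restrict to \<open>M\<close>; every structure map on \<open>M\<close> extends in this way,
  and the axioms concern the restriction to \<open>M\<close> only.
\<close>

locale right_module = vector_space sM
  for sH :: "'k::field \<Rightarrow> 'h::ring_1 \<Rightarrow> 'h" and sM :: "'k \<Rightarrow> 'm::ab_group_add \<Rightarrow> 'm" +
  fixes M :: "'m set" and act :: "'m \<Rightarrow> 'h \<Rightarrow> 'm"
  assumes carrier_subspace: "subspace M"
    and act_bilinear: "bilinear_map sM sH sM act"
    and act_closed: "m \<in> M \<Longrightarrow> act m h \<in> M"
    and act_one: "m \<in> M \<Longrightarrow> act m 1 = m"
    and act_mult: "m \<in> M \<Longrightarrow> act m (g * h) = act (act m g) h"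

locale right_comodule = vector_space sM
  for sC :: "'k::field \<Rightarrow> 'c::ab_group_add \<Rightarrow> 'c" and \<Delta> :: "'c \<Rightarrow> ('c \<times> 'c \<Rightarrow>\<^sub>0 'k)"
    and \<epsilon> :: "'c \<Rightarrow> 'k" and sM :: "'k \<Rightarrow> 'm::ab_group_add \<Rightarrow> 'm" +
  fixes M :: "'m set" and \<rho> :: "'m \<Rightarrow> ('m \<times> 'c \<Rightarrow>\<^sub>0 'k)"
  assumes carrier_subspace: "subspace M"
    and coact_linear: "Vector_Spaces.linear sM fscale \<rho>"
    and coact_closed: "m \<in> M \<Longrightarrow> \<rho> m \<in> tensor_space sM sC M UNIV"
    and coact_coassoc: "m \<in> M \<Longrightarrow>
      tlift fscale (\<lambda>m0 m1. tlift fscale (\<lambda>m00 m01. m00 \<otimes>\<^bsub>sM,fscale\<^esub> (m01 \<otimes>\<^bsub>sC,sC\<^esub> m1)) (\<rho> m0)) (\<rho> m)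
      = tlift fscale (\<lambda>m0 m1. m0 \<otimes>\<^bsub>sM,fscale\<^esub> \<Delta> m1) (\<rho> m)"
    and coact_counit: "m \<in> M \<Longrightarrow> tlift sM (\<lambda>m0 m1. sM (\<epsilon> m1) m0) (\<rho> m) = m"

locale module_coalgebra = coalgebra sC \<Delta>C \<epsilon>C + right_module sH sC UNIV act
  for sH :: "'k::field \<Rightarrow> 'h::ring_1 \<Rightarrow> 'h" and \<Delta>H :: "'h \<Rightarrow> ('h \<times> 'h \<Rightarrow>\<^sub>0 'k)" and \<epsilon>H :: "'h \<Rightarrow> 'k"
    and sC :: "'k \<Rightarrow> 'c::ab_group_add \<Rightarrow> 'c" and \<Delta>C :: "'c \<Rightarrow> ('c \<times> 'c \<Rightarrow>\<^sub>0 'k)" and \<epsilon>C :: "'c \<Rightarrow> 'k"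
    and act :: "'c \<Rightarrow> 'h \<Rightarrow> 'c" +
  assumes comult_act:
      "\<Delta>C (act c h) = tlift fscale (\<lambda>c1 c2. tlift fscale (\<lambda>h1 h2. act c1 h1 \<otimes>\<^bsub>sC,sC\<^esub> act c2 h2) (\<Delta>H h)) (\<Delta>C c)"
    and counit_act: "\<epsilon>C (act c h) = \<epsilon>C c * \<epsilon>H h"

text \<open>Objects of \<open>\<M>\<^sub>H\<^sup>C\<close>.\<close>

locale hopf_module = right_module sH sM M actM + right_comodule sC \<Delta>C \<epsilon>C sM M \<rho>
  for sH :: "'k::field \<Rightarrow> 'h::ring_1 \<Rightarrow> 'h" and \<Delta>H :: "'h \<Rightarrow> ('h \<times> 'h \<Rightarrow>\<^sub>0 'k)"
    and sC :: "'k \<Rightarrow> 'c::ab_group_add \<Rightarrow> 'c" and \<Delta>C :: "'c \<Rightarrow> ('c \<times> 'c \<Rightarrow>\<^sub>0 'k)" and \<epsilon>C :: "'c \<Rightarrow> 'k"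
    and actC :: "'c \<Rightarrow> 'h \<Rightarrow> 'c"
    and sM :: "'k \<Rightarrow> 'm::ab_group_add \<Rightarrow> 'm" and M :: "'m set" and actM :: "'m \<Rightarrow> 'h \<Rightarrow> 'm"
    and \<rho> :: "'m \<Rightarrow> ('m \<times> 'c \<Rightarrow>\<^sub>0 'k)" +
  assumes coact_act: "m \<in> M \<Longrightarrow>
    \<rho> (actM m h) = tlift fscale (\<lambda>m0 m1. tlift fscale (\<lambda>h1 h2. actM m0 h1 \<otimes>\<^bsub>sM,sC\<^esub> actC m1 h2) (\<Delta>H h)) (\<rho> m)"


section \<open>Twistings\<close>

definition Hom_HC ::
    "('k::field \<Rightarrow> 'h::ring_1 \<Rightarrow> 'h) \<Rightarrow> ('k \<Rightarrow> 'c::ab_group_add \<Rightarrow> 'c) \<Rightarrow> ('c \<Rightarrow> ('h \<times> 'c \<Rightarrow>\<^sub>0 'k)) set" where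
  "Hom_HC sH sC =
     {\<tau>. Vector_Spaces.linear sC fscale \<tau> \<and> (\<forall>c. \<tau> c \<in> tensor_space sH sC UNIV UNIV)}"

definition conv ::
    "('k::field \<Rightarrow> 'h::ring_1 \<Rightarrow> 'h) \<Rightarrow> ('k \<Rightarrow> 'c::ab_group_add \<Rightarrow> 'c) \<Rightarrow>
     ('c \<Rightarrow> ('h \<times> 'c \<Rightarrow>\<^sub>0 'k)) \<Rightarrow> ('c \<Rightarrow> ('h \<times> 'c \<Rightarrow>\<^sub>0 'k)) \<Rightarrow> 'c \<Rightarrow> ('h \<times> 'c \<Rightarrow>\<^sub>0 'k)" where
  "conv sH sC \<tau> \<upsilon> c =
     tlift fscale (\<lambda>h c0. tlift fscale (\<lambda>g c00. (h * g) \<otimes>\<^bsub>sH,sC\<^esub> c00) (\<upsilon> c0)) (\<tau> c)"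

definition conv_unit ::
    "('k::field \<Rightarrow> 'h::ring_1 \<Rightarrow> 'h) \<Rightarrow> ('k \<Rightarrow> 'c::ab_group_add \<Rightarrow> 'c) \<Rightarrow> 'c \<Rightarrow> ('h \<times> 'c \<Rightarrow>\<^sub>0 'k)" where
  "conv_unit sH sC c = 1 \<otimes>\<^bsub>sH,sC\<^esub> c"

definition conv_invertible ::
    "('k::field \<Rightarrow> 'h::ring_1 \<Rightarrow> 'h) \<Rightarrow> ('k \<Rightarrow> 'c::ab_group_add \<Rightarrow> 'c) \<Rightarrow> ('c \<Rightarrow> ('h \<times> 'c \<Rightarrow>\<^sub>0 'k)) \<Rightarrow> bool" where
  "conv_invertible sH sC \<tau> \<longleftrightarrow> \<tau> \<in> Hom_HC sH sC \<and>
     (\<exists>\<upsilon>\<in>Hom_HC sH sC. conv sH sC \<tau> \<upsilon> = conv_unit sH sC \<and> conv sH sC \<upsilon> \<tau> = conv_unit sH sC)"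

definition normalized ::
    "('k::field \<Rightarrow> 'h::ring_1 \<Rightarrow> 'h) \<Rightarrow> ('h \<Rightarrow> 'k) \<Rightarrow> ('k \<Rightarrow> 'c::ab_group_add \<Rightarrow> 'c) \<Rightarrow> ('c \<Rightarrow> 'k) \<Rightarrow>
     ('c \<Rightarrow> ('h \<times> 'c \<Rightarrow>\<^sub>0 'k)) \<Rightarrow> bool" where
  "normalized sH \<epsilon>H sC \<epsilon>C \<tau> \<longleftrightarrow> (\<forall>c.
     tlift sH (\<lambda>h c0. sH (\<epsilon>C c0) h) (\<tau> c) = sH (\<epsilon>C c) 1 \<and>
     tlift sC (\<lambda>h c0. sC (\<epsilon>H h) c0) (\<tau> c) = c)"

text \<open>
  \<open>\<rho>\<^sup>\<tau>(m) = m\<^sub>0 \<cdot> \<tau>(m\<^sub>1)\<^sub>-\<^sub>1 \<otimes> \<tau>(m\<^sub>1)\<^sub>0\<close>. Taking \<open>M = C\<close> and \<open>\<rho> = \<Delta>\<close> gives \<open>\<Delta>\<^sub>\<tau>\<close>.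
\<close>

definition twist_coact ::
    "('k::field \<Rightarrow> 'c::ab_group_add \<Rightarrow> 'c) \<Rightarrow> ('c \<Rightarrow> ('h \<times> 'c \<Rightarrow>\<^sub>0 'k)) \<Rightarrow>
     ('k \<Rightarrow> 'm::ab_group_add \<Rightarrow> 'm) \<Rightarrow> ('m \<Rightarrow> 'h \<Rightarrow> 'm) \<Rightarrow> ('m \<Rightarrow> ('m \<times> 'c \<Rightarrow>\<^sub>0 'k)) \<Rightarrow>
     'm \<Rightarrow> ('m \<times> 'c \<Rightarrow>\<^sub>0 'k)" where
  "twist_coact sC \<tau> sM actM \<rho> m =
     tlift fscale (\<lambda>m0 m1. tlift fscale (\<lambda>h c. actM m0 h \<otimes>\<^bsub>sM,sC\<^esub> c) (\<tau> m1)) (\<rho> m)"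

definition twist_comult ::
    "('k::field \<Rightarrow> 'c::ab_group_add \<Rightarrow> 'c) \<Rightarrow> ('c \<Rightarrow> ('c \<times> 'c \<Rightarrow>\<^sub>0 'k)) \<Rightarrow> ('c \<Rightarrow> 'h \<Rightarrow> 'c) \<Rightarrow>
     ('c \<Rightarrow> ('h \<times> 'c \<Rightarrow>\<^sub>0 'k)) \<Rightarrow> 'c \<Rightarrow> ('c \<times> 'c \<Rightarrow>\<^sub>0 'k)" where
  "twist_comult sC \<Delta>C actC \<tau> = twist_coact sC \<tau> sC actC \<Delta>C"

text \<open>
  The last clause of the definition of a twisting ranges over all Hopf modules \<open>M\<close>. HOL cannot
  quantify over all types, so \<open>M\<close> runs over all Hopf modules whose underlying space is a subspace
  of the vector space with basis \<open>'c \<times> 'h \<times> nat\<close>; up to isomorphism these are all Hopf modules of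
  dimension at most \<open>|'c \<times> 'h \<times> nat|\<close>. This is no restriction: by the finiteness theorem for
  comodules every element of a Hopf module \<open>M\<close> lies in a finite-dimensional subcomodule \<open>V\<close>,
  hence in the Hopf submodule \<open>V \<cdot> H\<close>, whose dimension is at most \<open>|'h \<times> nat|\<close>; and
  \<open>M\<^sup>\<tau> \<in> \<M>\<^sub>H\<^sup>D\<close>, with \<open>D = C\<^sup>\<tau>\<close>, holds as soon as it holds for all these submodules.
\<close>

definition twisting ::
    "('k::field \<Rightarrow> 'h::ring_1 \<Rightarrow> 'h) \<Rightarrow> ('h \<Rightarrow> ('h \<times> 'h \<Rightarrow>\<^sub>0 'k)) \<Rightarrow> ('h \<Rightarrow> 'k) \<Rightarrow>
     ('k \<Rightarrow> 'c::ab_group_add \<Rightarrow> 'c) \<Rightarrow> ('c \<Rightarrow> ('c \<times> 'c \<Rightarrow>\<^sub>0 'k)) \<Rightarrow> ('c \<Rightarrow> 'k) \<Rightarrow> ('c \<Rightarrow> 'h \<Rightarrow> 'c) \<Rightarrow>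
     ('c \<Rightarrow> ('h \<times> 'c \<Rightarrow>\<^sub>0 'k)) \<Rightarrow> bool" where
  "twisting sH \<Delta>H \<epsilon>H sC \<Delta>C \<epsilon>C actC \<tau> \<longleftrightarrow>
     \<tau> \<in> Hom_HC sH sC \<and> normalized sH \<epsilon>H sC \<epsilon>C \<tau> \<and>
     module_coalgebra sH \<Delta>H \<epsilon>H sC (twist_comult sC \<Delta>C actC \<tau>) \<epsilon>C actC \<and>
     (\<forall>(M :: ('c \<times> 'h \<times> nat \<Rightarrow>\<^sub>0 'k) set) actM \<rho>.
        hopf_module sH \<Delta>H sC \<Delta>C \<epsilon>C actC fscale M actM \<rho> \<longrightarrow>
        hopf_module sH \<Delta>H sC (twist_comult sC \<Delta>C actC \<tau>) \<epsilon>C actC fscale M actM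
          (twist_coact sC \<tau> fscale actM \<rho>))"


section \<open>Galois coextensions\<close>

text \<open>\<open>DH\<^sup>+\<close>\<close>

definition aug_sub ::
    "('h \<Rightarrow> 'k::field) \<Rightarrow> ('k \<Rightarrow> 'd::ab_group_add \<Rightarrow> 'd) \<Rightarrow> ('d \<Rightarrow> 'h \<Rightarrow> 'd) \<Rightarrow> 'd set" where
  "aug_sub \<epsilon>H sD act = module.span sD {act d h | d h. \<epsilon>H h = 0}"

text \<open>The projection \<open>\<pi> : D \<rightarrow> B = D/DH\<^sup>+\<close>; it depends only on the module structure of \<open>D\<close>.\<close>

definition proj_B ::
    "('h \<Rightarrow> 'k::field) \<Rightarrow> ('k \<Rightarrow> 'd::ab_group_add \<Rightarrow> 'd) \<Rightarrow> ('d \<Rightarrow> 'h \<Rightarrow> 'd) \<Rightarrow> 'd \<Rightarrow> 'd" where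
  "proj_B \<epsilon>H sD act = quot_map sD (aug_sub \<epsilon>H sD act)"

text \<open>
  The cotensor product \<open>X \<box>\<^sub>B Y\<close> of a right comodule \<open>\<rho> : X \<rightarrow> X \<otimes> B\<close> and a left comodule
  \<open>\<mu> : Y \<rightarrow> B \<otimes> Y\<close> is the equalizer of \<open>\<rho> \<otimes> id\<close> and \<open>id \<otimes> \<mu>\<close>.
\<close>

definition cotensor ::
    "('k::field \<Rightarrow> 'x::ab_group_add \<Rightarrow> 'x) \<Rightarrow> ('k \<Rightarrow> 'b::ab_group_add \<Rightarrow> 'b) \<Rightarrow>
     ('k \<Rightarrow> 'y::ab_group_add \<Rightarrow> 'y) \<Rightarrow> ('x \<Rightarrow> ('x \<times> 'b \<Rightarrow>\<^sub>0 'k)) \<Rightarrow> ('y \<Rightarrow> ('b \<times> 'y \<Rightarrow>\<^sub>0 'k)) \<Rightarrow>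
     ('x \<times> 'y \<Rightarrow>\<^sub>0 'k) set" where
  "cotensor sX sB sY \<rho> \<mu> = {t \<in> tensor_space sX sY UNIV UNIV.
     tlift fscale (\<lambda>x y. tlift fscale (\<lambda>x0 b. x0 \<otimes>\<^bsub>sX,fscale\<^esub> (b \<otimes>\<^bsub>sB,sY\<^esub> y)) (\<rho> x)) t
     = tlift fscale (\<lambda>x y. x \<otimes>\<^bsub>sX,fscale\<^esub> \<mu> y) t}"

definition right_B_coact ::
    "('h \<Rightarrow> 'k::field) \<Rightarrow> ('k \<Rightarrow> 'd::ab_group_add \<Rightarrow> 'd) \<Rightarrow> ('d \<Rightarrow> ('d \<times> 'd \<Rightarrow>\<^sub>0 'k)) \<Rightarrow> ('d \<Rightarrow> 'h \<Rightarrow> 'd) \<Rightarrow>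
     'd \<Rightarrow> ('d \<times> 'd \<Rightarrow>\<^sub>0 'k)" where
  "right_B_coact \<epsilon>H sD \<Delta>D act d =
     tlift fscale (\<lambda>d1 d2. d1 \<otimes>\<^bsub>sD,sD\<^esub> proj_B \<epsilon>H sD act d2) (\<Delta>D d)"

definition left_B_coact ::
    "('h \<Rightarrow> 'k::field) \<Rightarrow> ('k \<Rightarrow> 'd::ab_group_add \<Rightarrow> 'd) \<Rightarrow> ('d \<Rightarrow> ('d \<times> 'd \<Rightarrow>\<^sub>0 'k)) \<Rightarrow> ('d \<Rightarrow> 'h \<Rightarrow> 'd) \<Rightarrow>
     'd \<Rightarrow> ('d \<times> 'd \<Rightarrow>\<^sub>0 'k)" where
  "left_B_coact \<epsilon>H sD \<Delta>D act d =
     tlift fscale (\<lambda>d1 d2. proj_B \<epsilon>H sD act d1 \<otimes>\<^bsub>sD,sD\<^esub> d2) (\<Delta>D d)"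

definition canonical_map ::
    "('k::field \<Rightarrow> 'd::ab_group_add \<Rightarrow> 'd) \<Rightarrow> ('d \<Rightarrow> ('d \<times> 'd \<Rightarrow>\<^sub>0 'k)) \<Rightarrow> ('d \<Rightarrow> 'h \<Rightarrow> 'd) \<Rightarrow>
     ('d \<times> 'h \<Rightarrow>\<^sub>0 'k) \<Rightarrow> ('d \<times> 'd \<Rightarrow>\<^sub>0 'k)" where
  "canonical_map sD \<Delta>D act t =
     tlift fscale (\<lambda>d h. tlift fscale (\<lambda>d1 d2. d1 \<otimes>\<^bsub>sD,sD\<^esub> act d2 h) (\<Delta>D d)) t"

text \<open>\<open>D/B\<close> is an \<open>H\<close>-Galois coextension, where \<open>B = D/DH\<^sup>+\<close>.\<close>

definition galois_coextension ::
    "('k::field \<Rightarrow> 'h::ring_1 \<Rightarrow> 'h) \<Rightarrow> ('h \<Rightarrow> ('h \<times> 'h \<Rightarrow>\<^sub>0 'k)) \<Rightarrow> ('h \<Rightarrow> 'k) \<Rightarrow>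
     ('k \<Rightarrow> 'd::ab_group_add \<Rightarrow> 'd) \<Rightarrow> ('d \<Rightarrow> ('d \<times> 'd \<Rightarrow>\<^sub>0 'k)) \<Rightarrow> ('d \<Rightarrow> 'k) \<Rightarrow> ('d \<Rightarrow> 'h \<Rightarrow> 'd) \<Rightarrow> bool" where
  "galois_coextension sH \<Delta>H \<epsilon>H sD \<Delta>D \<epsilon>D act \<longleftrightarrow>
     module_coalgebra sH \<Delta>H \<epsilon>H sD \<Delta>D \<epsilon>D act \<and>
     bij_betw (canonical_map sD \<Delta>D act) (tensor_space sD sH UNIV UNIV)
       (cotensor sD sD sD (right_B_coact \<epsilon>H sD \<Delta>D act) (left_B_coact \<epsilon>H sD \<Delta>D act))"

end

theory Submission
  imports Defs
begin

text \<open>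
  Both \<open>C \<box>\<^sub>B C\<close> and \<open>C\<^sup>\<tau> \<box>\<^sub>B C\<^sup>\<tau>\<close> are subspaces of \<open>C \<otimes> C\<close>. Twisting leaves the left coaction
  \<open>c \<mapsto> \<pi>(c\<^sub>1) \<otimes> c\<^sub>2\<close> of \<open>B\<close> unchanged, because \<open>\<pi>(c \<cdot> h) = \<epsilon>(h) \<pi>(c)\<close> and \<open>\<tau>\<close> is normalized, but it
  changes the right coaction. The change is undone by a single linear map, the untwisting map
  \<open>g(c) = c\<^sub>0 \<cdot> S\<^sup>-\<^sup>1(c\<^sub>-\<^sub>1)\<close>, where \<open>\<tau>(c) = c\<^sub>-\<^sub>1 \<otimes> c\<^sub>0\<close>: it intertwines the right \<open>B\<close>-coactions of \<open>C\<close> and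
  \<open>C\<^sup>\<tau>\<close> (\<open>right_B_coact_untwist\<close>), commutes with the action of \<open>H\<close> (\<open>untwist_act\<close>), and is bijective,
  its inverse being built in the same way from the convolution inverse of \<open>\<tau>\<close> (\<open>untwist_inverse\<close>).
  Hence \<open>g \<otimes> id\<close> maps \<open>C \<box>\<^sub>B C\<close> bijectively onto \<open>C\<^sup>\<tau> \<box>\<^sub>B C\<^sup>\<tau>\<close> (\<open>untwist_left_cotensor_iff\<close>).

  To compare the canonical maps under \<open>g \<otimes> id\<close>, replace \<open>c \<otimes> h \<mapsto> c\<^sub>1 \<otimes> c\<^sub>2 \<cdot> h\<close> by
  \<open>c \<otimes> h \<mapsto> c\<^sub>1 \<cdot> h \<otimes> c\<^sub>2\<close>; the two differ by the bijection \<open>c \<otimes> h \<mapsto> c \<cdot> h\<^sub>1 \<otimes> S(h\<^sub>2)\<close> of \<open>C \<otimes> H\<close>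
  (\<open>canonical_map_shear\<close>). In this form \<open>g \<otimes> id\<close> carries the canonical map of \<open>C\<close> to that of \<open>C\<^sup>\<tau>\<close>
  composed with the bijection \<open>c \<otimes> h \<mapsto> c\<^sub>0 \<otimes> S\<^sup>-\<^sup>1(c\<^sub>-\<^sub>1) h\<close> of \<open>C \<otimes> H\<close>
  (\<open>untwist_left_canonical_map'\<close>). So one canonical map is a bijection onto its cotensor product
  if and only if the other one is.

  These computations rest on two identities for \<open>\<tau>\<close>, called \<open>equivariant\<close> and \<open>compatible\<close> below. Both
  are read off from the axioms of \<open>M\<^sup>\<tau>\<close> for the Hopf module \<open>M = H \<otimes> C\<close> with diagonal action and
  coaction \<open>id \<otimes> \<Delta>\<close>, by applying \<open>id \<otimes> \<epsilon>\<close> to the first factor \<open>M\<close>.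

  Sweedler notation is rendered by nested \<open>tlift\<close>. An identity between tensors is mostly used in the
  form obtained by applying a multilinear map to both sides, as in \<open>coassoc_trilinear\<close> or
  \<open>equivariant_bilinear\<close>.
\<close>

section \<open>Linear maps and tensor products\<close>

abbreviation lin where "lin \<equiv> Vector_Spaces.linear"

text \<open>
  Closure rules for linearity, one for each operation and each argument position. In a multilinear
  term every variable occurs exactly once, so that the position of this occurrence determines the
  next rule, and \<open>intro lins\<close> proves linearity in any chosen variable.
\<close>
named_theorems lins

lemma vs_field [lins, simp]: "vector_space ((*) :: 'k::field \<Rightarrow> 'k \<Rightarrow> 'k)"
  by unfold_locales (auto simp: algebra_simps)

lemmas vs_fscale [lins, simp] = vector_space_fscale

lemma lin_id [lins]: "vector_space s \<Longrightarrow> lin s s (\<lambda>x. x)"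
  by (simp add: Vector_Spaces.linear_iff)

lemma lin_comp: "lin t u f \<Longrightarrow> lin s t g \<Longrightarrow> lin s u (\<lambda>x. f (g x))"
  by (simp add: Vector_Spaces.linear_iff)

lemma lin_tlift_arg [lins]:
  "vector_space sX \<Longrightarrow> lin s fscale f \<Longrightarrow> lin s sX (\<lambda>x. tlift sX \<beta> (f x))"
  by (rule lin_comp[OF linear_tlift])

lemma tlift_lin: "lin sX sY f \<Longrightarrow> f (tlift sX \<beta> t) = tlift sY (\<lambda>a b. f (\<beta> a b)) t"
proof -
  assume f: "lin sX sY f"
  interpret f: Vector_Spaces.linear sX sY f by fact
  show ?thesis by (simp add: tlift_def f.sum f.scale split_beta)
qed

lemma tlift_tlift:
  "vector_space sX \<Longrightarrow> tlift sX \<gamma> (tlift fscale \<beta> t) = tlift sX (\<lambda>a b. tlift sX \<gamma> (\<beta> a b)) t"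
  by (rule tlift_lin[OF linear_tlift])

lemma lin_tlift_body [lins]:
  assumes "\<And>a b. lin sV sX (\<lambda>x. \<beta> x a b)"
  shows "lin sV sX (\<lambda>x. tlift sX (\<beta> x) t)"
proof -
  have *: "vector_space sX" "vector_space sV"
    using assms[of undefined undefined] by (simp_all add: Vector_Spaces.linear_iff)
  interpret vector_space sX by fact
  show ?thesis using assms *
    by (simp add: Vector_Spaces.linear_iff tlift_def sum.distrib scale_right_distrib
        scale_sum_right split_beta mult.commute)
qed

lemma tlift_swap:
  assumes "vector_space sX"
  shows "tlift sX (\<lambda>a b. tlift sX (\<lambda>c d. e a b c d) u) t
    = tlift sX (\<lambda>c d. tlift sX (\<lambda>a b. e a b c d) t) u"
proof -
  interpret vector_space sX by fact
  show ?thesis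
    by (simp add: tlift_def scale_sum_right split_beta mult.commute
        sum.swap[of _ "Poly_Mapping.keys t"])
qed

lemma lin_scale_left [lins]: "vector_space sX \<Longrightarrow> lin s (*) f \<Longrightarrow> lin s sX (\<lambda>x. sX (f x) v)"
  by (simp add: Vector_Spaces.linear_iff vector_space.vector_space_assms)

lemma lin_scale_right [lins]:
  assumes "lin s sX f"
  shows "lin s sX (\<lambda>x. sX r (f x))"
proof -
  interpret f: Vector_Spaces.linear s sX f by fact
  show ?thesis
    using assms by (simp add: Vector_Spaces.linear_iff f.vs2.scale_right_distrib mult.commute)
qed

lemma bilinear_mapI [lins]:
  "(\<And>v. lin sW sX (\<beta> v)) \<Longrightarrow> (\<And>w. lin sV sX (\<lambda>v. \<beta> v w)) \<Longrightarrow> bilinear_map sV sW sX \<beta>"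
  by (simp add: bilinear_map_def)

lemma bilinear_map_comp1: "bilinear_map sV sW sX \<beta> \<Longrightarrow> lin s sV f \<Longrightarrow> lin s sX (\<lambda>x. \<beta> (f x) w)"
  by (auto simp: bilinear_map_def intro: lin_comp)

lemma bilinear_map_comp2: "bilinear_map sV sW sX \<beta> \<Longrightarrow> lin s sW f \<Longrightarrow> lin s sX (\<lambda>x. \<beta> w (f x))"
  by (auto simp: bilinear_map_def intro: lin_comp)

lemma lin_tensor1 [lins]:
  "vector_space sV \<Longrightarrow> vector_space sW \<Longrightarrow> lin s sV f \<Longrightarrow> lin s fscale (\<lambda>x. f x \<otimes>\<^bsub>sV,sW\<^esub> w)"
  by (rule bilinear_map_comp1[OF bilinear_tensor])

lemma lin_tensor2 [lins]:
  "vector_space sV \<Longrightarrow> vector_space sW \<Longrightarrow> lin s sW f \<Longrightarrow> lin s fscale (\<lambda>x. v \<otimes>\<^bsub>sV,sW\<^esub> f x)"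
  by (rule bilinear_map_comp2[OF bilinear_tensor])

lemma tensor_tlift1:
  "vector_space sV \<Longrightarrow> vector_space sW \<Longrightarrow>
    tlift sV \<beta> t \<otimes>\<^bsub>sV,sW\<^esub> w = tlift fscale (\<lambda>a b. \<beta> a b \<otimes>\<^bsub>sV,sW\<^esub> w) t"
  by (rule tlift_lin[where f = "\<lambda>x. x \<otimes>\<^bsub>sV,sW\<^esub> w"]) (intro lins)

lemma tlift_single [simp]:
  assumes "vector_space sX"
  shows "tlift sX \<beta> (Poly_Mapping.single (v, w) 1) = \<beta> v w"
  using assms by (simp add: tlift_def vector_space.vector_space_assms)

lemma tlift_single_id: "tlift fscale (\<lambda>v w. Poly_Mapping.single (v, w) 1) t = t"
proof (rule poly_mapping_eqI)
  fix k
  have "Poly_Mapping.lookup (tlift fscale (\<lambda>v w. Poly_Mapping.single (v, w) 1) t) k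
      = (\<Sum>k'\<in>Poly_Mapping.keys t. if k' = k then Poly_Mapping.lookup t k' else 0)"
    unfolding tlift_def lookup_sum split_beta
    by (rule sum.cong) (auto simp: lookup_single when_def)
  then show "Poly_Mapping.lookup (tlift fscale (\<lambda>v w. Poly_Mapping.single (v, w) 1) t) k
      = Poly_Mapping.lookup t k"
    by (simp add: in_keys_iff)
qed

abbreviation TS where "TS sV sW \<equiv> tensor_space sV sW UNIV UNIV"

lemma tensor_in_TS [simp]:
  fixes sV :: "'c::field \<Rightarrow> 'a::ab_group_add \<Rightarrow> 'a" and sW :: "'c \<Rightarrow> 'b::ab_group_add \<Rightarrow> 'b"
  shows "v \<otimes>\<^bsub>sV,sW\<^esub> w \<in> TS sV sW"
proof -
  interpret vector_space "fscale :: 'c \<Rightarrow> ('a \<times> 'b \<Rightarrow>\<^sub>0 'c) \<Rightarrow> _" by simp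
  show ?thesis unfolding tensor_space_def by (rule span_base) blast
qed

lemma subspace_TS [simp]:
  fixes sV :: "'a::field \<Rightarrow> 'b::ab_group_add \<Rightarrow> 'b" and sW :: "'a \<Rightarrow> 'c::ab_group_add \<Rightarrow> 'c"
  shows "module.subspace fscale (tensor_space sV sW A B)"
proof -
  interpret vector_space "fscale :: 'a \<Rightarrow> ('b \<times> 'c \<Rightarrow>\<^sub>0 'a) \<Rightarrow> _" by simp
  show ?thesis unfolding tensor_space_def by (rule subspace_span)
qed

lemma tlift_in_subspace:
  assumes "vector_space sX" and "module.subspace sX U" and "\<And>a b. \<beta> a b \<in> U"
  shows "tlift sX \<beta> t \<in> U"
proof -
  interpret vector_space sX by fact
  show ?thesis unfolding tlift_def split_beta using assms(2,3)
    by (intro subspace_sum subspace_scale)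
qed

lemma tensor_space_eqI:
  assumes "t \<in> tensor_space sV sW A B" and "lin fscale sX f" and "lin fscale sX g"
    and "\<And>v w. v \<in> A \<Longrightarrow> w \<in> B \<Longrightarrow> f (v \<otimes>\<^bsub>sV,sW\<^esub> w) = g (v \<otimes>\<^bsub>sV,sW\<^esub> w)"
  shows "f t = g t"
proof -
  interpret f: Vector_Spaces.linear fscale sX f by fact
  interpret g: Vector_Spaces.linear fscale sX g by fact
  from assms(1) show ?thesis unfolding tensor_space_def
    by (induction rule: f.vs1.span_induct_alt) (auto simp: f.add g.add f.scale g.scale assms(4))
qed

lemma linear_in_subspace:
  assumes "t \<in> tensor_space sV sW A B" and "lin fscale sX f" and "module.subspace sX U"
    and "\<And>v w. v \<in> A \<Longrightarrow> w \<in> B \<Longrightarrow> f (v \<otimes>\<^bsub>sV,sW\<^esub> w) \<in> U"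
  shows "f t \<in> U"
proof -
  interpret f: Vector_Spaces.linear fscale sX f by fact
  from assms(1) show ?thesis unfolding tensor_space_def
    by (induction rule: f.vs1.span_induct_alt)
      (auto simp: f.add f.scale assms(3,4) f.vs2.subspace_0 intro!: f.vs2.subspace_add f.vs2.subspace_scale)
qed

lemma bij_betw_tensor_spaceI:
  assumes f: "lin fscale fscale f" and g: "lin fscale fscale g"
    and fT: "\<And>v w. f (v \<otimes>\<^bsub>sV,sW\<^esub> w) \<in> TS sX sY" and gT: "\<And>x y. g (x \<otimes>\<^bsub>sX,sY\<^esub> y) \<in> TS sV sW"
    and gf: "\<And>v w. g (f (v \<otimes>\<^bsub>sV,sW\<^esub> w)) = v \<otimes>\<^bsub>sV,sW\<^esub> w"
    and fg: "\<And>x y. f (g (x \<otimes>\<^bsub>sX,sY\<^esub> y)) = x \<otimes>\<^bsub>sX,sY\<^esub> y"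
  shows "bij_betw f (TS sV sW) (TS sX sY)"
proof (rule bij_betw_byWitness[where f' = g])
  show "\<forall>t\<in>TS sV sW. g (f t) = t"
    using tensor_space_eqI[where g = "\<lambda>t. t", OF _ lin_comp[OF g f] lin_id[OF vs_fscale]] gf by blast
  show "\<forall>t\<in>TS sX sY. f (g t) = t"
    using tensor_space_eqI[where g = "\<lambda>t. t", OF _ lin_comp[OF f g] lin_id[OF vs_fscale]] fg by blast
  show "f ` TS sV sW \<subseteq> TS sX sY" using linear_in_subspace[OF _ f subspace_TS] fT by blast
  show "g ` TS sX sY \<subseteq> TS sV sW" using linear_in_subspace[OF _ g subspace_TS] gT by blast
qed


lemma lin_scaleD: "lin s t f \<Longrightarrow> f (s r x) = t r (f x)"
  by (simp add: Vector_Spaces.linear_iff)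

section \<open>Hopf algebras\<close>

context coalgebra
begin

lemma vs_C [lins, simp]: "vector_space sC"
  by (rule vector_space_axioms)

lemma lin_comult [lins]: "lin s sC f \<Longrightarrow> lin s fscale (\<lambda>x. \<Delta> (f x))"
  by (rule lin_comp[OF comult_linear])

lemma lin_counit [lins]: "lin s sC f \<Longrightarrow> lin s (*) (\<lambda>x. \<epsilon> (f x))"
  by (rule lin_comp[OF counit_linear])

lemma coassoc_trilinear:
  assumes "\<And>b c. lin sC sX (\<lambda>a. e a b c)" "\<And>a c. lin sC sX (\<lambda>b. e a b c)" "\<And>a b. lin sC sX (e a b)"
  shows "tlift sX (\<lambda>c1 c2. tlift sX (\<lambda>a b. e a b c2) (\<Delta> c1)) (\<Delta> c)
    = tlift sX (\<lambda>c1 c2. tlift sX (e c1) (\<Delta> c2)) (\<Delta> c)"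
proof -
  have [lins, simp]: "vector_space sX"
    using assms(3) by (simp add: Vector_Spaces.linear_iff)
  have b: "bilinear_map sC fscale sX (\<lambda>a. tlift sX (e a))" "bilinear_map sC sC sX (e a)" for a
    by (intro lins assms)+
  show ?thesis
    using arg_cong[OF coassoc, of "tlift sX (\<lambda>a. tlift sX (e a))" c]
    by (simp add: tlift_tlift tlift_tensor[OF b(1)] tlift_tensor[OF b(2)])
qed

lemma counit_left_linear: "lin sC sX f \<Longrightarrow> tlift sX (\<lambda>c1 c2. sX (\<epsilon> c1) (f c2)) (\<Delta> c) = f c"
  using tlift_lin[of sC sX f "\<lambda>c1 c2. sC (\<epsilon> c1) c2" "\<Delta> c"] by (simp add: counit_left lin_scaleD)

lemma counit_right_linear: "lin sC sX f \<Longrightarrow> tlift sX (\<lambda>c1 c2. sX (\<epsilon> c2) (f c1)) (\<Delta> c) = f c"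
  using tlift_lin[of sC sX f "\<lambda>c1 c2. sC (\<epsilon> c2) c1" "\<Delta> c"] by (simp add: counit_right lin_scaleD)

end

context hopf_algebra
begin

lemma lin_mult1 [lins]: "lin s sH f \<Longrightarrow> lin s sH (\<lambda>x. f x * h)"
  by (rule bilinear_map_comp1[OF mult_bilinear])

lemma lin_mult2 [lins]: "lin s sH f \<Longrightarrow> lin s sH (\<lambda>x. h * f x)"
  by (rule bilinear_map_comp2[OF mult_bilinear])

lemma lin_antipode [lins]: "lin s sH f \<Longrightarrow> lin s sH (\<lambda>x. S (f x))"
  by (rule lin_comp[OF antipode_linear])

lemma antipode_left_linear:
  assumes "lin sH sX f"
  shows "tlift sX (\<lambda>h1 h2. f (S h1 * h2)) (\<Delta> h) = sX (\<epsilon> h) (f 1)"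
  using tlift_lin[OF assms, of "\<lambda>h1 h2. S h1 * h2" "\<Delta> h"] assms
  by (simp add: antipode_left lin_scaleD)

lemma antipode_right_linear:
  assumes "lin sH sX f"
  shows "tlift sX (\<lambda>h1 h2. f (h1 * S h2)) (\<Delta> h) = sX (\<epsilon> h) (f 1)"
  using tlift_lin[OF assms, of "\<lambda>h1 h2. h1 * S h2" "\<Delta> h"] assms
  by (simp add: antipode_right lin_scaleD)

lemma comult_mult_bilinear:
  assumes "bilinear_map sH sH sX e"
  shows "tlift sX (\<lambda>g1 g2. tlift sX (\<lambda>h1 h2. e (g1 * h1) (g2 * h2)) (\<Delta> h)) (\<Delta> g) = tlift sX e (\<Delta> (g * h))"
proof -
  have "vector_space sX"
    using assms by (auto simp: bilinear_map_def Vector_Spaces.linear_iff)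
  then show ?thesis by (simp add: comult_mult tlift_tlift tlift_tensor[OF assms])
qed

text \<open>
  Both sides are convolution inverses of the multiplication \<open>H \<otimes> H \<rightarrow> H\<close>. Concretely, the expression
  \<open>S(g\<^sub>1 h\<^sub>1) g\<^sub>2 h\<^sub>2 S(h\<^sub>3) S(g\<^sub>3)\<close> is evaluated in two ways: cancelling \<open>h\<^sub>2 S(h\<^sub>3)\<close> and then
  \<open>g\<^sub>2 S(g\<^sub>3)\<close> leaves \<open>S(g h)\<close>, while cancelling \<open>S(g\<^sub>1 h\<^sub>1) g\<^sub>2 h\<^sub>2\<close> leaves \<open>S(h) S(g)\<close>.
\<close>
lemma antipode_mult: "S (g * h) = S h * S g"
proof -
  let ?e = "\<lambda>g1 h1 g2 h2 h3 g3. S (g1 * h1) * ((g2 * h2) * (S h3 * S g3))"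
  let ?X = "tlift sH (\<lambda>g1 g'. tlift sH (\<lambda>g2 g3. tlift sH (\<lambda>h1 h'. tlift sH (\<lambda>h2 h3.
      ?e g1 h1 g2 h2 h3 g3) (\<Delta> h')) (\<Delta> h)) (\<Delta> g')) (\<Delta> g)"
  have 1: "tlift sH (\<lambda>h2 h3. ?e g1 h1 g2 h2 h3 g3) (\<Delta> h')
      = sH (\<epsilon> h') (S (g1 * h1) * (g2 * S g3))" for g1 h1 g2 g3 h'
    using antipode_right_linear[where sX = sH and f = "\<lambda>x. S (g1 * h1) * ((g2 * x) * S g3)" and h = h']
    by (simp add: mult.assoc lins)
  have 2: "tlift sH (\<lambda>h1 h'. tlift sH (\<lambda>h2 h3. ?e g1 h1 g2 h2 h3 g3) (\<Delta> h')) (\<Delta> h)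
      = S (g1 * h) * (g2 * S g3)" for g1 g2 g3
    unfolding 1 by (rule counit_right_linear) (intro lins)
  have 3: "?X = S (g * h)"
    using antipode_right_linear[where sX = sH and f = "\<lambda>x. S (_ * h) * x"]
    unfolding 2 by (simp add: lins counit_right_linear[where f = "\<lambda>x. S (x * h)"])
  \<comment> \<open>for the second evaluation, the first two legs of \<open>g\<close> and of \<open>h\<close> are grouped together\<close>
  have "?X = tlift sH (\<lambda>g1 g'. tlift sH (\<lambda>g2 g3. tlift sH (\<lambda>h' h3. tlift sH (\<lambda>h1 h2.
      ?e g1 h1 g2 h2 h3 g3) (\<Delta> h')) (\<Delta> h)) (\<Delta> g')) (\<Delta> g)"
    by (subst coassoc_trilinear) (intro lins refl)+
  also have "\<dots> = tlift sH (\<lambda>g' g3. tlift sH (\<lambda>g1 g2. tlift sH (\<lambda>h' h3. tlift sH (\<lambda>h1 h2.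
      ?e g1 h1 g2 h2 h3 g3) (\<Delta> h')) (\<Delta> h)) (\<Delta> g')) (\<Delta> g)"
    by (rule coassoc_trilinear[symmetric]) (intro lins)+
  also have "\<dots> = tlift sH (\<lambda>g' g3. tlift sH (\<lambda>h' h3. tlift sH (\<lambda>g1 g2. tlift sH (\<lambda>h1 h2.
      ?e g1 h1 g2 h2 h3 g3) (\<Delta> h')) (\<Delta> g')) (\<Delta> h)) (\<Delta> g)"
    by (subst tlift_swap) (intro lins refl)+
  also have "\<dots> = tlift sH (\<lambda>g' g3. tlift sH (\<lambda>h' h3. sH (\<epsilon> g') (sH (\<epsilon> h') (S h3 * S g3))) (\<Delta> h)) (\<Delta> g)"
  proof -
    have "tlift sH (\<lambda>g1 g2. tlift sH (\<lambda>h1 h2. ?e g1 h1 g2 h2 h3 g3) (\<Delta> h')) (\<Delta> g')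
        = tlift sH (\<lambda>x y. S x * (y * (S h3 * S g3))) (\<Delta> (g' * h'))" for g' h' g3 h3
      by (rule comult_mult_bilinear) (intro lins)
    also have "\<dots> g' h' g3 h3 = sH (\<epsilon> g') (sH (\<epsilon> h') (S h3 * S g3))" for g' h' g3 h3
      using antipode_left_linear[where sX = sH and f = "\<lambda>x. x * (S h3 * S g3)" and h = "g' * h'"]
      by (simp add: mult.assoc lins counit_mult)
    finally show ?thesis by simp
  qed
  also have "\<dots> = S h * S g"
  proof -
    have "tlift sH (\<lambda>h' h3. sH (\<epsilon> g') (sH (\<epsilon> h') (S h3 * S g3))) (\<Delta> h) = sH (\<epsilon> g') (S h * S g3)" for g' g3
    proof -
      have "lin sH sH (\<lambda>x. sH (\<epsilon> g') (S x * S g3))" by (intro lins)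
      from counit_left_linear[OF this, of h] show ?thesis by (simp add: mult.commute)
    qed
    moreover have "lin sH sH (\<lambda>x. S h * S x)" by (intro lins)
    ultimately show ?thesis by (simp add: counit_left_linear[where sX = sH and f = "\<lambda>x. S h * S x"])
  qed
  finally show ?thesis using 3 by simp
qed

lemma antipode_one: "S 1 = 1"
proof -
  have "bilinear_map sH sH sH (\<lambda>h1 h2. S h1 * h2)" by (intro lins)
  then show ?thesis
    using antipode_left[of 1] by (simp add: comult_one tlift_tensor counit_one)
qed

end


lemma (in right_module) lin_act1 [lins]: "lin s sM f \<Longrightarrow> lin s sM (\<lambda>x. act (f x) h)"
  by (rule bilinear_map_comp1[OF act_bilinear])

lemma (in right_module) lin_act2 [lins]: "lin s sH f \<Longrightarrow> lin s sM (\<lambda>x. act m (f x))"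
  by (rule bilinear_map_comp2[OF act_bilinear])

lemma (in module_coalgebra) comult_act_bilinear:
  assumes "bilinear_map sC sC sX e"
  shows "tlift sX e (\<Delta>C (act c h))
    = tlift sX (\<lambda>c1 c2. tlift sX (\<lambda>h1 h2. e (act c1 h1) (act c2 h2)) (\<Delta>H h)) (\<Delta>C c)"
proof -
  have "vector_space sX"
    using assms by (auto simp: bilinear_map_def Vector_Spaces.linear_iff)
  then show ?thesis by (simp add: comult_act tlift_tlift tlift_tensor[OF assms])
qed

locale bijective_antipode = hopf_algebra +
  assumes bij_antipode: "bij S"
begin

abbreviation S' where "S' \<equiv> inv S"

lemma antipode_inv [simp]: "S (S' h) = h" "S' (S h) = h"
  using bij_antipode by (simp_all add: bij_def surj_f_inv_f)

lemma antipode_inject: "S x = S y \<Longrightarrow> x = y"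
  by (metis antipode_inv(2))

lemma linear_antipode_inv: "lin sH sH S'"
  unfolding Vector_Spaces.linear_iff
proof (intro conjI allI vs_C)
  interpret S: Vector_Spaces.linear sH sH S by (rule antipode_linear)
  show "S' (x + y) = S' x + S' y" for x y by (rule antipode_inject) (simp add: S.add)
  show "S' (sH r x) = sH r (S' x)" for r x by (rule antipode_inject) (simp add: S.scale)
qed

lemma lin_antipode_inv [lins]: "lin s sH f \<Longrightarrow> lin s sH (\<lambda>x. S' (f x))"
  by (rule lin_comp[OF linear_antipode_inv])

lemma antipode_inv_mult: "S' (g * h) = S' h * S' g"
  by (rule antipode_inject) (simp add: antipode_mult)

lemma antipode_inv_one: "S' 1 = 1"
  by (rule antipode_inject) (simp add: antipode_one)

text \<open>
  The inverse antipode satisfies the antipode identities with the two legs of \<open>\<Delta>(h)\<close> interchanged: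
  apply \<open>S\<^sup>-\<^sup>1\<close>, which reverses products, to those for \<open>S\<close>.
\<close>
lemma antipode_inv_left_linear:
  assumes "lin sH sX f"
  shows "tlift sX (\<lambda>h1 h2. f (S' h2 * h1)) (\<Delta> h) = sX (\<epsilon> h) (f 1)"
proof -
  have "lin sH sX (\<lambda>x. f (S' x))" by (rule lin_comp[OF assms linear_antipode_inv])
  from antipode_left_linear[OF this, of h] show ?thesis
    by (simp add: antipode_inv_mult antipode_inv_one)
qed

lemma antipode_inv_right_linear:
  assumes "lin sH sX f"
  shows "tlift sX (\<lambda>h1 h2. f (h2 * S' h1)) (\<Delta> h) = sX (\<epsilon> h) (f 1)"
proof -
  have "lin sH sX (\<lambda>x. f (S' x))" by (rule lin_comp[OF assms linear_antipode_inv])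
  from antipode_right_linear[OF this, of h] show ?thesis
    by (simp add: antipode_inv_mult antipode_inv_one)
qed

end

section \<open>Two forms of the canonical map\<close>
locale hopf_module_coalgebra = H: bijective_antipode sH \<Delta>H \<epsilon>H S
    + C: module_coalgebra sH \<Delta>H \<epsilon>H sC \<Delta>C \<epsilon>C act
  for sH :: "'k::field \<Rightarrow> 'h::ring_1 \<Rightarrow> 'h"
    and \<Delta>H :: "'h \<Rightarrow> ('h \<times> 'h \<Rightarrow>\<^sub>0 'k)" and \<epsilon>H :: "'h \<Rightarrow> 'k" and S :: "'h \<Rightarrow> 'h"
    and sC :: "'k \<Rightarrow> 'c::ab_group_add \<Rightarrow> 'c"
    and \<Delta>C :: "'c \<Rightarrow> ('c \<times> 'c \<Rightarrow>\<^sub>0 'k)" and \<epsilon>C :: "'c \<Rightarrow> 'k" and act :: "'c \<Rightarrow> 'h \<Rightarrow> 'c"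
begin

abbreviation S' where "S' \<equiv> inv S"

text \<open>
  The form of the canonical map in which \<open>H\<close> acts on the first factor. It is adapted to maps
  \<open>g \<otimes> id\<close> with \<open>g\<close> linear over \<open>H\<close>, since these commute with the action on the first factor.
\<close>
definition canonical_map' :: "('c \<times> 'h \<Rightarrow>\<^sub>0 'k) \<Rightarrow> ('c \<times> 'c \<Rightarrow>\<^sub>0 'k)" where
  "canonical_map' = tlift fscale (\<lambda>c h. tlift fscale (\<lambda>c1 c2. act c1 h \<otimes>\<^bsub>sC,sC\<^esub> c2) (\<Delta>C c))"

definition shear :: "('c \<times> 'h \<Rightarrow>\<^sub>0 'k) \<Rightarrow> ('c \<times> 'h \<Rightarrow>\<^sub>0 'k)" where
  "shear = tlift fscale (\<lambda>c h. tlift fscale (\<lambda>h1 h2. act c h1 \<otimes>\<^bsub>sC,sH\<^esub> S h2) (\<Delta>H h))"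

definition unshear :: "('c \<times> 'h \<Rightarrow>\<^sub>0 'k) \<Rightarrow> ('c \<times> 'h \<Rightarrow>\<^sub>0 'k)" where
  "unshear = tlift fscale (\<lambda>c h. tlift fscale (\<lambda>h1 h2. act c (S h1) \<otimes>\<^bsub>sC,sH\<^esub> h2) (\<Delta>H (S' h)))"

lemma act_one [simp]: "act c 1 = c" and act_act [simp]: "act (act c g) h = act c (g * h)"
  by (simp_all add: C.act_one C.act_mult)

lemma tensor_scale: "sC r c \<otimes>\<^bsub>sC,sW\<^esub> w = fscale r (c \<otimes>\<^bsub>sC,sW\<^esub> w)" if "vector_space sW"
  by (rule lin_scaleD[where f = "\<lambda>x. x \<otimes>\<^bsub>sC,sW\<^esub> w"]) (intro lins that)

lemma canonical_map'_tensor: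
  "canonical_map' (c \<otimes>\<^bsub>sC,sH\<^esub> h) = tlift fscale (\<lambda>c1 c2. act c1 h \<otimes>\<^bsub>sC,sC\<^esub> c2) (\<Delta>C c)"
  unfolding canonical_map'_def by (rule tlift_tensor) (intro lins)

lemma shear_tensor:
  "shear (c \<otimes>\<^bsub>sC,sH\<^esub> h) = tlift fscale (\<lambda>h1 h2. act c h1 \<otimes>\<^bsub>sC,sH\<^esub> S h2) (\<Delta>H h)"
  unfolding shear_def by (rule tlift_tensor) (intro lins)

lemma unshear_tensor:
  "unshear (c \<otimes>\<^bsub>sC,sH\<^esub> h) = tlift fscale (\<lambda>h1 h2. act c (S h1) \<otimes>\<^bsub>sC,sH\<^esub> h2) (\<Delta>H (S' h))"
  unfolding unshear_def by (rule tlift_tensor) (intro lins)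

lemma canonical_map_tensor:
  "canonical_map sC \<Delta>C act (c \<otimes>\<^bsub>sC,sH\<^esub> h)
    = tlift fscale (\<lambda>c1 c2. c1 \<otimes>\<^bsub>sC,sC\<^esub> act c2 h) (\<Delta>C c)"
  unfolding canonical_map_def by (rule tlift_tensor) (intro lins)

lemma bij_betw_shear: "bij_betw shear (TS sC sH) (TS sC sH)"
proof (rule bij_betw_tensor_spaceI)
  show "lin fscale fscale shear" "lin fscale fscale unshear"
    unfolding shear_def unshear_def by (rule linear_tlift, simp)+
  show "shear (c \<otimes>\<^bsub>sC,sH\<^esub> h) \<in> TS sC sH" "unshear (c \<otimes>\<^bsub>sC,sH\<^esub> h) \<in> TS sC sH" for c h
    unfolding shear_tensor unshear_tensor by (rule tlift_in_subspace, simp_all)+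
  fix c h
  have "unshear (shear (c \<otimes>\<^bsub>sC,sH\<^esub> h))
      = tlift fscale (\<lambda>h1 h2. unshear (act c h1 \<otimes>\<^bsub>sC,sH\<^esub> S h2)) (\<Delta>H h)"
    unfolding shear_tensor by (simp add: unshear_def tlift_tlift)
  also have "\<dots> = tlift fscale (\<lambda>h1 h2. tlift fscale (\<lambda>a b. act c (h1 * S a) \<otimes>\<^bsub>sC,sH\<^esub> b) (\<Delta>H h2)) (\<Delta>H h)"
    by (simp add: unshear_tensor)
  also have "\<dots> = tlift fscale (\<lambda>h1 h2. tlift fscale (\<lambda>a b. act c (a * S b) \<otimes>\<^bsub>sC,sH\<^esub> h2) (\<Delta>H h1)) (\<Delta>H h)"
    by (rule H.coassoc_trilinear[symmetric]) (intro lins)+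
  also have "\<dots> = tlift fscale (\<lambda>h1 h2. fscale (\<epsilon>H h1) (act c 1 \<otimes>\<^bsub>sC,sH\<^esub> h2)) (\<Delta>H h)"
    by (subst H.antipode_right_linear) (intro lins refl)+
  also have "\<dots> = c \<otimes>\<^bsub>sC,sH\<^esub> h"
    by (subst H.counit_left_linear) (simp_all add: lins)
  finally show "unshear (shear (c \<otimes>\<^bsub>sC,sH\<^esub> h)) = c \<otimes>\<^bsub>sC,sH\<^esub> h" .
  have "shear (unshear (c \<otimes>\<^bsub>sC,sH\<^esub> h))
      = tlift fscale (\<lambda>h1 h2. shear (act c (S h1) \<otimes>\<^bsub>sC,sH\<^esub> h2)) (\<Delta>H (S' h))"
    unfolding unshear_tensor by (simp add: shear_def tlift_tlift)
  also have "\<dots> = tlift fscale (\<lambda>h1 h2. tlift fscale (\<lambda>a b. act c (S h1 * a) \<otimes>\<^bsub>sC,sH\<^esub> S b) (\<Delta>H h2)) (\<Delta>H (S' h))"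
    by (simp add: shear_tensor)
  also have "\<dots> = tlift fscale (\<lambda>h1 h2. tlift fscale (\<lambda>a b. act c (S a * b) \<otimes>\<^bsub>sC,sH\<^esub> S h2) (\<Delta>H h1)) (\<Delta>H (S' h))"
    by (rule H.coassoc_trilinear[symmetric]) (intro lins)+
  also have "\<dots> = tlift fscale (\<lambda>h1 h2. fscale (\<epsilon>H h1) (act c 1 \<otimes>\<^bsub>sC,sH\<^esub> S h2)) (\<Delta>H (S' h))"
    by (subst H.antipode_left_linear) (intro lins refl)+
  also have "\<dots> = c \<otimes>\<^bsub>sC,sH\<^esub> h"
    by (subst H.counit_left_linear) (simp_all add: lins)
  finally show "shear (unshear (c \<otimes>\<^bsub>sC,sH\<^esub> h)) = c \<otimes>\<^bsub>sC,sH\<^esub> h" .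
qed

text \<open>
  Since \<open>\<Delta>(c \<cdot> h) = c\<^sub>1 \<cdot> h\<^sub>1 \<otimes> c\<^sub>2 \<cdot> h\<^sub>2\<close>, the canonical map sends \<open>c \<cdot> h\<^sub>1 \<otimes> S(h\<^sub>2)\<close> to
  \<open>c\<^sub>1 \<cdot> h\<^sub>1 \<otimes> c\<^sub>2 \<cdot> h\<^sub>2 S(h\<^sub>3) = c\<^sub>1 \<cdot> h \<otimes> c\<^sub>2\<close>.
\<close>
lemma canonical_map_shear:
  assumes "t \<in> TS sC sH"
  shows "canonical_map sC \<Delta>C act (shear t) = canonical_map' t"
proof (rule tensor_space_eqI[OF assms])
  have can: "lin fscale fscale (canonical_map sC \<Delta>C act)"
    unfolding canonical_map_def by (rule linear_tlift) simp
  show "lin fscale fscale (\<lambda>t. canonical_map sC \<Delta>C act (shear t))"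
    unfolding shear_def by (intro lin_comp[OF can] linear_tlift vs_fscale)
  show "lin fscale fscale canonical_map'"
    unfolding canonical_map'_def by (rule linear_tlift) simp
  fix c h
  have "canonical_map sC \<Delta>C act (shear (c \<otimes>\<^bsub>sC,sH\<^esub> h))
      = tlift fscale (\<lambda>h1 h2. canonical_map sC \<Delta>C act (act c h1 \<otimes>\<^bsub>sC,sH\<^esub> S h2)) (\<Delta>H h)"
    unfolding shear_tensor by (rule tlift_lin[OF can])
  also have "\<dots> = tlift fscale (\<lambda>h1 h2. tlift fscale (\<lambda>c1 c2. tlift fscale (\<lambda>a b.
      act c1 a \<otimes>\<^bsub>sC,sC\<^esub> act c2 (b * S h2)) (\<Delta>H h1)) (\<Delta>C c)) (\<Delta>H h)"
    unfolding canonical_map_tensor by (subst C.comult_act_bilinear) (simp_all add: lins)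
  also have "\<dots> = tlift fscale (\<lambda>c1 c2. tlift fscale (\<lambda>h1 h2. tlift fscale (\<lambda>a b.
      act c1 a \<otimes>\<^bsub>sC,sC\<^esub> act c2 (b * S h2)) (\<Delta>H h1)) (\<Delta>H h)) (\<Delta>C c)"
    by (rule tlift_swap) simp
  also have "\<dots> = tlift fscale (\<lambda>c1 c2. tlift fscale (\<lambda>h1 h2. tlift fscale (\<lambda>a b.
      act c1 h1 \<otimes>\<^bsub>sC,sC\<^esub> act c2 (a * S b)) (\<Delta>H h2)) (\<Delta>H h)) (\<Delta>C c)"
    by (subst H.coassoc_trilinear) (intro lins refl)+
  also have "\<dots> = tlift fscale (\<lambda>c1 c2. tlift fscale (\<lambda>h1 h2.
      fscale (\<epsilon>H h2) (act c1 h1 \<otimes>\<^bsub>sC,sC\<^esub> act c2 1)) (\<Delta>H h)) (\<Delta>C c)"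
    by (subst H.antipode_right_linear) (intro lins refl)+
  also have "\<dots> = tlift fscale (\<lambda>c1 c2. act c1 h \<otimes>\<^bsub>sC,sC\<^esub> c2) (\<Delta>C c)"
    by (subst H.counit_right_linear) (simp_all add: lins)
  finally show "canonical_map sC \<Delta>C act (shear (c \<otimes>\<^bsub>sC,sH\<^esub> h)) = canonical_map' (c \<otimes>\<^bsub>sC,sH\<^esub> h)"
    by (simp add: canonical_map'_tensor)
qed

end

section \<open>The untwisting map\<close>

context hopf_module_coalgebra
begin

text \<open>
  In Sweedler notation, \<open>c\<^sub>-\<^sub>1 h\<^sub>1 \<otimes> c\<^sub>0 \<cdot> h\<^sub>2 = h\<^sub>1 (c \<cdot> h\<^sub>2)\<^sub>-\<^sub>1 \<otimes> (c \<cdot> h\<^sub>2)\<^sub>0\<close>. Equivalently, the left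
  \<open>H\<close>-linear map \<open>h \<otimes> c \<mapsto> h c\<^sub>-\<^sub>1 \<otimes> c\<^sub>0\<close> of \<open>H \<otimes> C\<close> is also right \<open>H\<close>-linear for the diagonal
  action.
\<close>
definition equivariant :: "('c \<Rightarrow> ('h \<times> 'c \<Rightarrow>\<^sub>0 'k)) \<Rightarrow> bool" where
  "equivariant \<tau> \<longleftrightarrow> (\<forall>c h.
     tlift fscale (\<lambda>x d. tlift fscale (\<lambda>h1 h2. (x * h1) \<otimes>\<^bsub>sH,sC\<^esub> act d h2) (\<Delta>H h)) (\<tau> c)
     = tlift fscale (\<lambda>h1 h2. tlift fscale (\<lambda>x d. (h1 * x) \<otimes>\<^bsub>sH,sC\<^esub> d) (\<tau> (act c h2))) (\<Delta>H h))"

lemma equivariant_bilinear: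
  assumes "equivariant \<tau>" and e: "bilinear_map sH sC sX e"
  shows "tlift sX (\<lambda>x d. tlift sX (\<lambda>h1 h2. e (x * h1) (act d h2)) (\<Delta>H h)) (\<tau> c)
    = tlift sX (\<lambda>h1 h2. tlift sX (\<lambda>x d. e (h1 * x) d) (\<tau> (act c h2))) (\<Delta>H h)"
proof -
  have "vector_space sX"
    using e by (auto simp: bilinear_map_def Vector_Spaces.linear_iff)
  then show ?thesis
    using arg_cong[OF assms(1)[unfolded equivariant_def, rule_format], of "tlift sX e" h c]
    by (simp add: tlift_tlift tlift_tensor[OF e])
qed

lemma conv_unit_bilinear:
  assumes "conv sH sC \<tau> \<upsilon> = conv_unit sH sC" and e: "bilinear_map sH sC sX e"
  shows "tlift sX (\<lambda>x d. tlift sX (\<lambda>y d'. e (x * y) d') (\<upsilon> d)) (\<tau> c) = e 1 c"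
proof -
  have "vector_space sX"
    using e by (auto simp: bilinear_map_def Vector_Spaces.linear_iff)
  then show ?thesis
    using arg_cong[OF fun_cong[OF assms(1)], of "tlift sX e" c]
    by (simp add: conv_def conv_unit_def tlift_tlift tlift_tensor[OF e])
qed

text \<open>
  Convolution inverse elements \<open>\<tau>\<close>, \<open>\<upsilon>\<close> induce mutually inverse maps of \<open>H \<otimes> C\<close>, and the inverse of a
  right \<open>H\<close>-linear bijection is right \<open>H\<close>-linear. On elements: insert \<open>\<tau> * \<upsilon>\<close> after the action of \<open>h\<close>,
  move \<open>h\<close> past \<open>\<tau>\<close> by equivariance, and cancel \<open>\<upsilon> * \<tau>\<close>.
\<close>
lemma equivariant_inverse:
  assumes lin: "lin sC fscale \<tau>" "lin sC fscale \<upsilon>"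
    and conv: "conv sH sC \<tau> \<upsilon> = conv_unit sH sC" "conv sH sC \<upsilon> \<tau> = conv_unit sH sC"
    and eq: "equivariant \<tau>"
  shows "equivariant \<upsilon>"
  unfolding equivariant_def
proof (intro allI)
  fix c h
  note [lins] = lin_comp[OF lin(1)] lin_comp[OF lin(2)]
  let ?E = "\<lambda>x d. tlift fscale (\<lambda>y d'. (x * y) \<otimes>\<^bsub>sH,sC\<^esub> d') (\<upsilon> d)"
  have E: "bilinear_map sH sC fscale ?E" by (intro lins)
  have E': "bilinear_map sH sC fscale (\<lambda>y d. ?E (x * y) d)" for x by (intro lins)
  have ins: "tlift fscale (\<lambda>y d. ?E (x * y) d) (\<tau> c) = x \<otimes>\<^bsub>sH,sC\<^esub> c" for x c
    using conv_unit_bilinear[OF conv(1), of fscale "\<lambda>y d. (x * y) \<otimes>\<^bsub>sH,sC\<^esub> d" c]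
    by (simp add: mult.assoc lins)
  have "tlift fscale (\<lambda>x d. tlift fscale (\<lambda>h1 h2. (x * h1) \<otimes>\<^bsub>sH,sC\<^esub> act d h2) (\<Delta>H h)) (\<upsilon> c)
      = tlift fscale (\<lambda>x d. tlift fscale (\<lambda>h1 h2. tlift fscale (\<lambda>y d'. ?E (x * (h1 * y)) d')
          (\<tau> (act d h2))) (\<Delta>H h)) (\<upsilon> c)"
    by (subst ins[symmetric]) (simp add: mult.assoc)
  also have "\<dots> = tlift fscale (\<lambda>x d. tlift fscale (\<lambda>y d'. tlift fscale (\<lambda>h1 h2.
      ?E ((x * y) * h1) (act d' h2)) (\<Delta>H h)) (\<tau> d)) (\<upsilon> c)"
    by (subst equivariant_bilinear[OF eq E', symmetric]) (simp add: mult.assoc)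
  also have "\<dots> = tlift fscale (\<lambda>h1 h2. ?E (1 * h1) (act c h2)) (\<Delta>H h)"
    by (subst conv_unit_bilinear[OF conv(2), of fscale "\<lambda>x d. tlift fscale (\<lambda>h1 h2.
      ?E (x * h1) (act d h2)) (\<Delta>H h)"]) (intro lins refl)+
  finally show "tlift fscale (\<lambda>x d. tlift fscale (\<lambda>h1 h2. (x * h1) \<otimes>\<^bsub>sH,sC\<^esub> act d h2) (\<Delta>H h)) (\<upsilon> c)
      = tlift fscale (\<lambda>h1 h2. tlift fscale (\<lambda>x d. (h1 * x) \<otimes>\<^bsub>sH,sC\<^esub> d) (\<upsilon> (act c h2))) (\<Delta>H h)"
    by simp
qed

text \<open>
  The map \<open>c \<mapsto> c\<^sub>0 \<cdot> S\<^sup>-\<^sup>1(c\<^sub>-\<^sub>1)\<close>. The inverse antipode, and not \<open>S\<close>, is the right choice: in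
  both identities for \<open>\<tau>\<close> the first leg \<open>h\<^sub>1\<close> of an element of \<open>H\<close> ends up in the factor \<open>H\<close> and the
  second leg \<open>h\<^sub>2\<close> acts on \<open>C\<close>, so the legs meet as \<open>h\<^sub>2 S\<^sup>-\<^sup>1(h\<^sub>1) = \<epsilon>(h) 1\<close>.
\<close>
definition untwist :: "('c \<Rightarrow> ('h \<times> 'c \<Rightarrow>\<^sub>0 'k)) \<Rightarrow> 'c \<Rightarrow> 'c" where
  "untwist \<tau> c = tlift sC (\<lambda>x d. act d (S' x)) (\<tau> c)"

lemma lin_untwist: "lin sC fscale \<tau> \<Longrightarrow> lin s sC f \<Longrightarrow> lin s sC (\<lambda>x. untwist \<tau> (f x))"
  unfolding untwist_def by (intro lins) (rule lin_comp)

text \<open>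
  Applying \<open>x \<otimes> d \<mapsto> d \<cdot> S\<^sup>-\<^sup>1(x)\<close> to equivariance gives \<open>g(c \<cdot> h\<^sub>2) \<cdot> S\<^sup>-\<^sup>1(h\<^sub>1) = \<epsilon>(h) g(c)\<close>, where \<open>g\<close>
  is the untwisting map. This determines \<open>g(c \<cdot> h)\<close>, since \<open>S\<^sup>-\<^sup>1(h\<^sub>2) h\<^sub>1 = \<epsilon>(h) 1\<close> allows one to
  cancel the factor \<open>S\<^sup>-\<^sup>1(h\<^sub>1)\<close> against one more leg of \<open>h\<close>.
\<close>
lemma untwist_act:
  assumes lin: "lin sC fscale \<tau>" and eq: "equivariant \<tau>"
  shows "untwist \<tau> (act c h) = act (untwist \<tau> c) h"
proof -
  note [lins] = lin_comp[OF lin] lin_untwist[OF lin]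
  have *: "tlift sC (\<lambda>h1 h2. act (untwist \<tau> (act c h2)) (S' h1 * k)) (\<Delta>H h)
      = sC (\<epsilon>H h) (act (untwist \<tau> c) k)" for h k
  proof -
    have "tlift sC (\<lambda>h1 h2. act (untwist \<tau> (act c h2)) (S' h1 * k)) (\<Delta>H h)
        = tlift sC (\<lambda>h1 h2. tlift sC (\<lambda>x d. act d (S' (h1 * x) * k)) (\<tau> (act c h2))) (\<Delta>H h)"
      unfolding untwist_def
      by (simp add: tlift_lin[of sC sC "\<lambda>c. act c _"] lins H.antipode_inv_mult mult.assoc)
    also have "\<dots> = tlift sC (\<lambda>x d. tlift sC (\<lambda>h1 h2. act (act d h2) (S' (x * h1) * k)) (\<Delta>H h)) (\<tau> c)"
      by (rule equivariant_bilinear[OF eq, symmetric]) (intro lins)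
    also have "\<dots> = tlift sC (\<lambda>x d. tlift sC (\<lambda>h1 h2. act d ((h2 * S' h1) * (S' x * k))) (\<Delta>H h)) (\<tau> c)"
      by (simp add: H.antipode_inv_mult mult.assoc)
    also have "\<dots> = tlift sC (\<lambda>x d. sC (\<epsilon>H h) (act d (1 * (S' x * k)))) (\<tau> c)"
      by (subst H.antipode_inv_right_linear) (intro lins refl)+
    also have "\<dots> = sC (\<epsilon>H h) (act (untwist \<tau> c) k)"
      unfolding untwist_def
      by (subst tlift_lin[of sC sC "\<lambda>c. sC (\<epsilon>H h) (act c k)"]) (intro lins, simp)
    finally show ?thesis .
  qed
  have "untwist \<tau> (act c h) = tlift sC (\<lambda>h1 h2. sC (\<epsilon>H h1) (act (untwist \<tau> (act c h2)) 1)) (\<Delta>H h)"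
    using H.counit_left_linear[where sX = sC and f = "\<lambda>x. untwist \<tau> (act c x)" and c = h]
    by (simp add: lins)
  also have "\<dots> = tlift sC (\<lambda>h1 h2. tlift sC (\<lambda>a b. act (untwist \<tau> (act c h2)) (S' b * a)) (\<Delta>H h1)) (\<Delta>H h)"
    by (subst H.antipode_inv_left_linear) (intro lins refl)+
  also have "\<dots> = tlift sC (\<lambda>h1 h2. tlift sC (\<lambda>a b. act (untwist \<tau> (act c b)) (S' a * h1)) (\<Delta>H h2)) (\<Delta>H h)"
    by (rule H.coassoc_trilinear) (intro lins)+
  also have "\<dots> = act (untwist \<tau> c) h"
    unfolding * by (rule H.counit_right_linear) (intro lins)
  finally show ?thesis .
qed

text \<open>
  Since the untwisting map of \<open>\<upsilon>\<close> is \<open>H\<close>-linear and \<open>S\<^sup>-\<^sup>1\<close> reverses products, the composition applies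
  \<open>x \<otimes> d \<mapsto> d \<cdot> S\<^sup>-\<^sup>1(x)\<close> to \<open>(\<tau> * \<upsilon>)(c) = 1 \<otimes> c\<close>.
\<close>
lemma untwist_inverse:
  assumes lin: "lin sC fscale \<tau>" "lin sC fscale \<upsilon>"
    and conv: "conv sH sC \<tau> \<upsilon> = conv_unit sH sC" and eq: "equivariant \<upsilon>"
  shows "untwist \<upsilon> (untwist \<tau> c) = c"
proof -
  note [lins] = lin_comp[OF lin(1)] lin_comp[OF lin(2)] lin_untwist[OF lin(2)]
  have "untwist \<upsilon> (untwist \<tau> c) = tlift sC (\<lambda>x d. untwist \<upsilon> (act d (S' x))) (\<tau> c)"
    unfolding untwist_def[of \<tau>] by (rule tlift_lin) (rule lin_untwist[OF lin(2) lin_id], simp)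
  also have "\<dots> = tlift sC (\<lambda>x d. act (untwist \<upsilon> d) (S' x)) (\<tau> c)"
    by (simp add: untwist_act[OF lin(2) eq])
  also have "\<dots> = tlift sC (\<lambda>x d. tlift sC (\<lambda>y d'. act d' (S' (x * y))) (\<upsilon> d)) (\<tau> c)"
    unfolding untwist_def
    by (simp add: tlift_lin[of sC sC "\<lambda>c. act c _"] lins H.antipode_inv_mult)
  also have "\<dots> = c"
    by (subst conv_unit_bilinear[OF conv, of sC "\<lambda>x d. act d (S' x)"])
      (simp_all add: lins H.antipode_inv_one)
  finally show ?thesis .
qed

text \<open>
  In Sweedler notation, \<open>c\<^sub>-\<^sub>1 \<otimes> \<Delta>\<^sub>\<tau>(c\<^sub>0) = c\<^sub>1\<^sub>.\<^sub>-\<^sub>1 c\<^sub>2\<^sub>.\<^sub>-\<^sub>1\<^sub>.\<^sub>1 \<otimes> c\<^sub>1\<^sub>.\<^sub>0 \<cdot> c\<^sub>2\<^sub>.\<^sub>-\<^sub>1\<^sub>.\<^sub>2 \<otimes> c\<^sub>2\<^sub>.\<^sub>0\<close>. This is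
  what remains of the coassociativity of the coaction of \<open>C\<^sup>\<tau>\<close> on \<open>(H \<otimes> C)\<^sup>\<tau>\<close> once \<open>\<epsilon>\<close> is applied to
  the factor \<open>C\<close> of \<open>H \<otimes> C\<close>.
\<close>
definition compatible :: "('c \<Rightarrow> ('h \<times> 'c \<Rightarrow>\<^sub>0 'k)) \<Rightarrow> bool" where
  "compatible \<tau> \<longleftrightarrow> (\<forall>c.
     tlift fscale (\<lambda>x d. x \<otimes>\<^bsub>sH,fscale\<^esub> twist_comult sC \<Delta>C act \<tau> d) (\<tau> c)
     = tlift fscale (\<lambda>c1 c2. tlift fscale (\<lambda>y d2. tlift fscale (\<lambda>x d1. tlift fscale (\<lambda>y1 y2.
         (x * y1) \<otimes>\<^bsub>sH,fscale\<^esub> (act d1 y2 \<otimes>\<^bsub>sC,sC\<^esub> d2)) (\<Delta>H y)) (\<tau> c1)) (\<tau> c2)) (\<Delta>C c))"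

lemma compatible_trilinear:
  assumes "compatible \<tau>"
    and e: "\<And>b c. lin sH sX (\<lambda>a. e a b c)" "\<And>a c. lin sC sX (\<lambda>b. e a b c)" "\<And>a b. lin sC sX (e a b)"
  shows "tlift sX (\<lambda>x d. tlift sX (\<lambda>d1 d2. e x d1 d2) (twist_comult sC \<Delta>C act \<tau> d)) (\<tau> c)
     = tlift sX (\<lambda>c1 c2. tlift sX (\<lambda>y d2. tlift sX (\<lambda>x d1. tlift sX (\<lambda>y1 y2.
         e (x * y1) (act d1 y2) d2) (\<Delta>H y)) (\<tau> c1)) (\<tau> c2)) (\<Delta>C c)"
proof -
  have [lins, simp]: "vector_space sX"
    using e(3) by (simp add: Vector_Spaces.linear_iff)
  have b: "bilinear_map sH fscale sX (\<lambda>a. tlift sX (e a))" "bilinear_map sC sC sX (e a)" for a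
    by (intro lins e)+
  show ?thesis
    using arg_cong[OF assms(1)[unfolded compatible_def, rule_format], of "tlift sX (\<lambda>a. tlift sX (e a))" c]
    by (simp add: tlift_tlift tlift_tensor[OF b(1)] tlift_tensor[OF b(2)])
qed

lemma normalized_counit_H:
  assumes "normalized sH \<epsilon>H sC \<epsilon>C \<tau>" and "lin sC sX f"
  shows "tlift sX (\<lambda>x d. sX (\<epsilon>H x) (f d)) (\<tau> c) = f c"
proof -
  have "tlift sC (\<lambda>x d. sC (\<epsilon>H x) d) (\<tau> c) = c"
    using assms(1) by (simp add: normalized_def)
  then show ?thesis
    using tlift_lin[OF assms(2), of "\<lambda>x d. sC (\<epsilon>H x) d" "\<tau> c"] assms(2) by (simp add: lin_scaleD)
qed

text \<open>
  The identity behind both the intertwining of the coactions of \<open>B\<close> and the comparison of the canonical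
  maps. By compatibility the left-hand side contains \<open>S\<^sup>-\<^sup>1(x y\<^sub>1) = S\<^sup>-\<^sup>1(y\<^sub>1) S\<^sup>-\<^sup>1(x)\<close> next to
  \<open>y\<^sub>2\<close>, where \<open>y\<close> is the component in \<open>H\<close> of \<open>\<tau>(c\<^sub>2)\<close>; so \<open>y\<close> survives only as \<open>\<epsilon>(y)\<close>, and
  normalization removes \<open>\<tau>(c\<^sub>2)\<close> altogether.
\<close>
lemma untwist_comult:
  assumes lin: "lin sC fscale \<tau>" and "compatible \<tau>" and norm: "normalized sH \<epsilon>H sC \<epsilon>C \<tau>"
    and e: "bilinear_map sC sC sX e"
  shows "tlift sX (\<lambda>x d. tlift sX (\<lambda>d1 d2. e (act d1 (S' x)) d2) (twist_comult sC \<Delta>C act \<tau> d)) (\<tau> c)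
     = tlift sX (\<lambda>c1 c2. e (untwist \<tau> c1) c2) (\<Delta>C c)"
proof -
  note [lins] = lin_comp[OF lin] lin_untwist[OF lin] bilinear_map_comp1[OF e] bilinear_map_comp2[OF e]
  have [lins, simp]: "vector_space sX"
    using e by (auto simp: bilinear_map_def Vector_Spaces.linear_iff)
  have "tlift sX (\<lambda>x d. tlift sX (\<lambda>d1 d2. e (act d1 (S' x)) d2) (twist_comult sC \<Delta>C act \<tau> d)) (\<tau> c)
      = tlift sX (\<lambda>c1 c2. tlift sX (\<lambda>y d2. tlift sX (\<lambda>x d1. tlift sX (\<lambda>y1 y2.
         e (act (act d1 y2) (S' (x * y1))) d2) (\<Delta>H y)) (\<tau> c1)) (\<tau> c2)) (\<Delta>C c)"
    by (rule compatible_trilinear[OF assms(2)]) (intro lins)+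
  also have "\<dots> = tlift sX (\<lambda>c1 c2. tlift sX (\<lambda>y d2. tlift sX (\<lambda>x d1. tlift sX (\<lambda>y1 y2.
         e (act d1 ((y2 * S' y1) * S' x)) d2) (\<Delta>H y)) (\<tau> c1)) (\<tau> c2)) (\<Delta>C c)"
    by (simp add: H.antipode_inv_mult mult.assoc)
  also have "\<dots> = tlift sX (\<lambda>c1 c2. tlift sX (\<lambda>y d2. tlift sX (\<lambda>x d1.
         sX (\<epsilon>H y) (e (act d1 (1 * S' x)) d2)) (\<tau> c1)) (\<tau> c2)) (\<Delta>C c)"
    by (subst H.antipode_inv_right_linear) (intro lins refl)+
  also have "\<dots> = tlift sX (\<lambda>c1 c2. tlift sX (\<lambda>y d2. sX (\<epsilon>H y) (e (untwist \<tau> c1) d2)) (\<tau> c2)) (\<Delta>C c)"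
  proof -
    have "lin sC sX (\<lambda>c. sX r (e c d2))" for r d2 by (intro lins)
    then have "sX r (e (untwist \<tau> c1) d2) = tlift sX (\<lambda>x d1. sX r (e (act d1 (1 * S' x)) d2)) (\<tau> c1)" for r c1 d2
      unfolding untwist_def by (subst tlift_lin) simp_all
    then show ?thesis by (simp only:)
  qed
  also have "\<dots> = tlift sX (\<lambda>c1 c2. e (untwist \<tau> c1) c2) (\<Delta>C c)"
    by (subst normalized_counit_H[OF norm]) (intro lins refl)+
  finally show ?thesis .
qed

end

section \<open>Identities from the Hopf module \<open>H \<otimes> C\<close>\<close>

context hopf_module_coalgebra
begin

text \<open>
  The definition of a twisting tests Hopf modules inside the free vector space on \<open>C \<times> H \<times> \<nat>\<close>. The
  Hopf module \<open>H \<otimes> C\<close> is moved there by relabelling basis elements; the linear left inverse \<open>unindex\<close>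
  extends its structure maps to the whole space.
\<close>
definition reindex :: "('h \<times> 'c \<Rightarrow>\<^sub>0 'k) \<Rightarrow> ('c \<times> 'h \<times> nat \<Rightarrow>\<^sub>0 'k)" where
  "reindex = tlift fscale (\<lambda>h c. Poly_Mapping.single (c, h, 0) 1)"

definition unindex :: "('c \<times> 'h \<times> nat \<Rightarrow>\<^sub>0 'k) \<Rightarrow> ('h \<times> 'c \<Rightarrow>\<^sub>0 'k)" where
  "unindex = tlift fscale (\<lambda>c hn. Poly_Mapping.single (fst hn, c) 1)"

definition \<iota> :: "'h \<Rightarrow> 'c \<Rightarrow> ('c \<times> 'h \<times> nat \<Rightarrow>\<^sub>0 'k)" where
  "\<iota> h c = reindex (h \<otimes>\<^bsub>sH,sC\<^esub> c)"

definition M :: "('c \<times> 'h \<times> nat \<Rightarrow>\<^sub>0 'k) set" where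
  "M = module.span fscale {\<iota> h c | h c. True}"

definition actM :: "('c \<times> 'h \<times> nat \<Rightarrow>\<^sub>0 'k) \<Rightarrow> 'h \<Rightarrow> ('c \<times> 'h \<times> nat \<Rightarrow>\<^sub>0 'k)" where
  "actM m g = tlift fscale (\<lambda>h c. tlift fscale (\<lambda>g1 g2. \<iota> (h * g1) (act c g2)) (\<Delta>H g)) (unindex m)"

definition coactM :: "('c \<times> 'h \<times> nat \<Rightarrow>\<^sub>0 'k) \<Rightarrow> (('c \<times> 'h \<times> nat \<Rightarrow>\<^sub>0 'k) \<times> 'c \<Rightarrow>\<^sub>0 'k)" where
  "coactM m = tlift fscale (\<lambda>h c. tlift fscale (\<lambda>c1 c2. \<iota> h c1 \<otimes>\<^bsub>fscale,sC\<^esub> c2) (\<Delta>C c)) (unindex m)"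

lemma unindex_reindex: "unindex (reindex t) = t"
  by (simp add: unindex_def reindex_def tlift_tlift tlift_single_id)

lemma unindex_\<iota>: "unindex (\<iota> h c) = h \<otimes>\<^bsub>sH,sC\<^esub> c"
  by (simp add: \<iota>_def unindex_reindex)

lemma lin_unindex [lins]: "lin s fscale f \<Longrightarrow> lin s fscale (\<lambda>x. unindex (f x))"
  unfolding unindex_def by (intro lins)

lemma lin_\<iota>1 [lins]: "lin s sH f \<Longrightarrow> lin s fscale (\<lambda>x. \<iota> (f x) c)"
  unfolding \<iota>_def reindex_def by (intro lins)

lemma lin_\<iota>2 [lins]: "lin s sC f \<Longrightarrow> lin s fscale (\<lambda>x. \<iota> h (f x))"
  unfolding \<iota>_def reindex_def by (intro lins)

lemma lin_actM1 [lins]: "lin s fscale f \<Longrightarrow> lin s fscale (\<lambda>x. actM (f x) g)"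
  unfolding actM_def by (intro lins)

lemma lin_actM2 [lins]: "lin s sH f \<Longrightarrow> lin s fscale (\<lambda>x. actM m (f x))"
  unfolding actM_def by (intro lins)

lemma lin_coactM [lins]: "lin s fscale f \<Longrightarrow> lin s fscale (\<lambda>x. coactM (f x))"
  unfolding coactM_def by (intro lins)

lemma actM_\<iota>: "actM (\<iota> h c) g = tlift fscale (\<lambda>g1 g2. \<iota> (h * g1) (act c g2)) (\<Delta>H g)"
  unfolding actM_def unindex_\<iota> by (rule tlift_tensor) (intro lins)

lemma coactM_\<iota>: "coactM (\<iota> h c) = tlift fscale (\<lambda>c1 c2. \<iota> h c1 \<otimes>\<^bsub>fscale,sC\<^esub> c2) (\<Delta>C c)"
  unfolding coactM_def unindex_\<iota> by (rule tlift_tensor) (intro lins)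

lemma subspace_M: "module.subspace fscale M"
proof -
  interpret vector_space "fscale :: 'k \<Rightarrow> ('c \<times> 'h \<times> nat \<Rightarrow>\<^sub>0 'k) \<Rightarrow> _" by simp
  show ?thesis unfolding M_def by (rule subspace_span)
qed

lemma \<iota>_in_M: "\<iota> h c \<in> M"
proof -
  interpret vector_space "fscale :: 'k \<Rightarrow> ('c \<times> 'h \<times> nat \<Rightarrow>\<^sub>0 'k) \<Rightarrow> _" by simp
  show ?thesis unfolding M_def by (rule span_base) blast
qed

lemma M_eqI:
  assumes "m \<in> M" and "lin fscale sX f" and "lin fscale sX g" and "\<And>h c. f (\<iota> h c) = g (\<iota> h c)"
  shows "f m = g m"
proof -
  interpret f: Vector_Spaces.linear fscale sX f by fact
  interpret g: Vector_Spaces.linear fscale sX g by fact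
  from assms(1) show ?thesis unfolding M_def
    by (induction rule: f.vs1.span_induct_alt) (auto simp: f.add g.add f.scale g.scale assms(4))
qed

lemma hopf_module_M: "hopf_module sH \<Delta>H sC \<Delta>C \<epsilon>C act fscale M actM coactM"
proof (intro hopf_module.intro right_module.intro right_comodule.intro right_module_axioms.intro
    right_comodule_axioms.intro hopf_module_axioms.intro vs_fscale subspace_M)
  show "bilinear_map fscale sH fscale actM"
    by (intro lins)
  show "lin fscale fscale coactM"
    by (rule lin_coactM[OF lin_id[OF vs_fscale]])
  show "actM m h \<in> M" for m h
    unfolding actM_def by (intro tlift_in_subspace subspace_M vs_fscale \<iota>_in_M)
  show "actM m 1 = m" if "m \<in> M" for m
  proof (rule M_eqI[where sX = fscale, OF that])
    have "bilinear_map sH sH fscale (\<lambda>g1 g2. \<iota> (h * g1) (act c g2))" for h c by (intro lins)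
    then show "actM (\<iota> h c) 1 = \<iota> h c" for h c
      by (simp add: actM_\<iota> H.comult_one tlift_tensor)
  qed (rule lin_actM1 lin_id vs_fscale)+
  show "actM m (g * k) = actM (actM m g) k" if "m \<in> M" for m g k
  proof (rule M_eqI[where sX = fscale, OF that])
    fix h c
    have "actM (actM (\<iota> h c) g) k = tlift fscale (\<lambda>g1 g2. actM (\<iota> (h * g1) (act c g2)) k) (\<Delta>H g)"
      unfolding actM_\<iota>[of h c g] by (rule tlift_lin[where f = "\<lambda>m. actM m k"]) (intro lins)
    also have "\<dots> = tlift fscale (\<lambda>g1 g2. tlift fscale (\<lambda>k1 k2.
        \<iota> (h * (g1 * k1)) (act c (g2 * k2))) (\<Delta>H k)) (\<Delta>H g)"
      by (simp add: actM_\<iota> mult.assoc)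
    also have "\<dots> = actM (\<iota> h c) (g * k)"
      unfolding actM_\<iota> by (rule H.comult_mult_bilinear) (intro lins)
    finally show "actM (\<iota> h c) (g * k) = actM (actM (\<iota> h c) g) k" by simp
  qed (intro lins)+
  show "coactM m \<in> tensor_space fscale sC M UNIV" for m
  proof -
    interpret vector_space "fscale :: 'k \<Rightarrow> (('c \<times> 'h \<times> nat \<Rightarrow>\<^sub>0 'k) \<times> 'c \<Rightarrow>\<^sub>0 'k) \<Rightarrow> _" by simp
    have "\<iota> h c1 \<otimes>\<^bsub>fscale,sC\<^esub> c2 \<in> tensor_space fscale sC M UNIV" for h c1 c2
      unfolding tensor_space_def using \<iota>_in_M by (intro span_base) blast
    then show ?thesis unfolding coactM_def by (intro tlift_in_subspace subspace_TS vs_fscale)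
  qed
  show "tlift fscale (\<lambda>m0 m1. tlift fscale (\<lambda>m00 m01. m00 \<otimes>\<^bsub>fscale,fscale\<^esub> (m01 \<otimes>\<^bsub>sC,sC\<^esub> m1)) (coactM m0)) (coactM m)
      = tlift fscale (\<lambda>m0 m1. m0 \<otimes>\<^bsub>fscale,fscale\<^esub> \<Delta>C m1) (coactM m)" if "m \<in> M" for m
  proof (rule M_eqI[where sX = fscale, OF that])
    fix h c
    have b1: "bilinear_map fscale sC fscale (\<lambda>m0 m1. tlift fscale (\<lambda>m00 m01.
        m00 \<otimes>\<^bsub>fscale,fscale\<^esub> (m01 \<otimes>\<^bsub>sC,sC\<^esub> m1)) (coactM m0))" by (intro lins)
    have b2: "bilinear_map fscale sC fscale (\<lambda>m00 m01. m00 \<otimes>\<^bsub>fscale,fscale\<^esub> (m01 \<otimes>\<^bsub>sC,sC\<^esub> c))" for c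
      by (intro lins)
    have b3: "bilinear_map fscale sC fscale (\<lambda>m0 m1. m0 \<otimes>\<^bsub>fscale,fscale\<^esub> \<Delta>C m1)" by (intro lins)
    have b4: "bilinear_map sC fscale fscale (\<lambda>a u. \<iota> h a \<otimes>\<^bsub>fscale,fscale\<^esub> u)" by (intro lins)
    show "tlift fscale (\<lambda>m0 m1. tlift fscale (\<lambda>m00 m01. m00 \<otimes>\<^bsub>fscale,fscale\<^esub> (m01 \<otimes>\<^bsub>sC,sC\<^esub> m1)) (coactM m0)) (coactM (\<iota> h c))
      = tlift fscale (\<lambda>m0 m1. m0 \<otimes>\<^bsub>fscale,fscale\<^esub> \<Delta>C m1) (coactM (\<iota> h c))"
      using arg_cong[OF C.coassoc, of "tlift fscale (\<lambda>a u. \<iota> h a \<otimes>\<^bsub>fscale,fscale\<^esub> u)" c]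
      by (simp add: coactM_\<iota> tlift_tlift tlift_tensor[OF b1] tlift_tensor[OF b2] tlift_tensor[OF b3]
          tlift_tensor[OF b4])
  qed (intro lins)+
  show "tlift fscale (\<lambda>m0 m1. fscale (\<epsilon>C m1) m0) (coactM m) = m" if "m \<in> M" for m
  proof (rule M_eqI[where sX = fscale, OF that _ lin_id[OF vs_fscale]])
    fix h c
    have b: "bilinear_map fscale sC fscale (\<lambda>m0 m1. fscale (\<epsilon>C m1) m0)" by (intro lins)
    have "tlift fscale (\<lambda>m0 m1. fscale (\<epsilon>C m1) m0) (coactM (\<iota> h c))
        = tlift fscale (\<lambda>c1 c2. fscale (\<epsilon>C c2) (\<iota> h c1)) (\<Delta>C c)"
      by (simp add: coactM_\<iota> tlift_tlift tlift_tensor[OF b])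
    also have "\<dots> = \<iota> h c" by (rule C.counit_right_linear) (intro lins)
    finally show "tlift fscale (\<lambda>m0 m1. fscale (\<epsilon>C m1) m0) (coactM (\<iota> h c)) = \<iota> h c" .
  qed (intro lins)
  show "coactM (actM m k) = tlift fscale (\<lambda>m0 m1. tlift fscale (\<lambda>h1 h2.
      actM m0 h1 \<otimes>\<^bsub>fscale,sC\<^esub> act m1 h2) (\<Delta>H k)) (coactM m)" if "m \<in> M" for m k
  proof (rule M_eqI[where sX = fscale, OF that])
    fix h c
    have b: "bilinear_map fscale sC fscale (\<lambda>m0 m1. tlift fscale (\<lambda>h1 h2.
      actM m0 h1 \<otimes>\<^bsub>fscale,sC\<^esub> act m1 h2) (\<Delta>H k))" by (intro lins)
    have "coactM (actM (\<iota> h c) k)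
        = tlift fscale (\<lambda>k1 k2. coactM (\<iota> (h * k1) (act c k2))) (\<Delta>H k)"
      unfolding actM_\<iota> by (rule tlift_lin) (rule lin_coactM[OF lin_id[OF vs_fscale]])
    also have "\<dots> = tlift fscale (\<lambda>k1 k2. tlift fscale (\<lambda>c1 c2. tlift fscale (\<lambda>a b.
        \<iota> (h * k1) (act c1 a) \<otimes>\<^bsub>fscale,sC\<^esub> act c2 b) (\<Delta>H k2)) (\<Delta>C c)) (\<Delta>H k)"
      unfolding coactM_\<iota> by (subst C.comult_act_bilinear) (intro lins refl)+
    also have "\<dots> = tlift fscale (\<lambda>c1 c2. tlift fscale (\<lambda>k1 k2. tlift fscale (\<lambda>a b.
        \<iota> (h * k1) (act c1 a) \<otimes>\<^bsub>fscale,sC\<^esub> act c2 b) (\<Delta>H k2)) (\<Delta>H k)) (\<Delta>C c)"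
      by (rule tlift_swap) simp
    also have "\<dots> = tlift fscale (\<lambda>c1 c2. tlift fscale (\<lambda>k1 k2. tlift fscale (\<lambda>a b.
        \<iota> (h * a) (act c1 b) \<otimes>\<^bsub>fscale,sC\<^esub> act c2 k2) (\<Delta>H k1)) (\<Delta>H k)) (\<Delta>C c)"
      by (subst H.coassoc_trilinear) (intro lins refl)+
    also have "\<dots> = tlift fscale (\<lambda>m0 m1. tlift fscale (\<lambda>h1 h2.
        actM m0 h1 \<otimes>\<^bsub>fscale,sC\<^esub> act m1 h2) (\<Delta>H k)) (coactM (\<iota> h c))"
      unfolding coactM_\<iota> by (simp add: tlift_tlift tensor_tlift1 tlift_tensor[OF b] actM_\<iota>)
    finally show "coactM (actM (\<iota> h c) k) = tlift fscale (\<lambda>m0 m1. tlift fscale (\<lambda>h1 h2.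
        actM m0 h1 \<otimes>\<^bsub>fscale,sC\<^esub> act m1 h2) (\<Delta>H k)) (coactM (\<iota> h c))" .
  qed (intro lins)+
qed

text \<open>
  The map \<open>id \<otimes> \<epsilon>\<close> on \<open>H \<otimes> C\<close>, which is right \<open>H\<close>-linear.
\<close>
definition collapse :: "('c \<times> 'h \<times> nat \<Rightarrow>\<^sub>0 'k) \<Rightarrow> 'h" where
  "collapse m = tlift sH (\<lambda>h c. sH (\<epsilon>C c) h) (unindex m)"

lemma lin_collapse [lins]: "lin s fscale f \<Longrightarrow> lin s sH (\<lambda>x. collapse (f x))"
  unfolding collapse_def by (intro lins)

lemma collapse_\<iota>: "collapse (\<iota> h c) = sH (\<epsilon>C c) h"
  unfolding collapse_def unindex_\<iota> by (rule tlift_tensor) (intro lins)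

lemma collapse_actM: "collapse (actM m g) = collapse m * g"
proof -
  have 1: "lin sH sH (\<lambda>x. sH r (h * x))" "lin sH sH (\<lambda>x. x * g)" for h r by (intro lins)+
  have "collapse (actM m g)
      = tlift sH (\<lambda>h c. tlift sH (\<lambda>g1 g2. collapse (\<iota> (h * g1) (act c g2))) (\<Delta>H g)) (unindex m)"
    unfolding actM_def
    by (simp add: tlift_lin[OF lin_collapse[OF lin_id[OF vs_fscale]]])
  also have "\<dots> = tlift sH (\<lambda>h c. tlift sH (\<lambda>g1 g2. sH (\<epsilon>H g2) (sH (\<epsilon>C c) (h * g1))) (\<Delta>H g)) (unindex m)"
    by (simp add: collapse_\<iota> C.counit_act mult.commute)
  also have "\<dots> = tlift sH (\<lambda>h c. sH (\<epsilon>C c) (h * g)) (unindex m)"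
    by (subst H.counit_right_linear) (rule 1 refl)+
  also have "\<dots> = collapse m * g"
  proof -
    have "sH r h * g = sH r (h * g)" for r h
      using 1(2) by (rule lin_scaleD)
    then show ?thesis unfolding collapse_def by (subst tlift_lin[OF 1(2)]) simp
  qed
  finally show ?thesis .
qed

text \<open>
  Applying \<open>id \<otimes> \<epsilon>\<close> to the factor \<open>M\<close> of the twisted coaction at \<open>1 \<otimes> c \<in> M\<close> returns \<open>\<tau>(c)\<close> (this is
  \<open>collapse_\<rho>\<close> below). Under this map, compatibility of the twisted coaction with the action becomes the first
  identity, and its coassociativity becomes the second one.
\<close>

lemma
  assumes lin: "lin sC fscale \<tau>"
    and hopf: "hopf_module sH \<Delta>H sC (twist_comult sC \<Delta>C act \<tau>) \<epsilon>C act fscale M actM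
      (twist_coact sC \<tau> fscale actM coactM)"
    and twisted: "module_coalgebra sH \<Delta>H \<epsilon>H sC (twist_comult sC \<Delta>C act \<tau>) \<epsilon>C act"
  shows twisted_hopf_module_equivariant: "equivariant \<tau>"
    and twisted_hopf_module_compatible: "compatible \<tau>"
proof -
  note [lins] = lin_comp[OF lin]
  let ?\<rho> = "twist_coact sC \<tau> fscale actM coactM"
  interpret T: hopf_module sH \<Delta>H sC "twist_comult sC \<Delta>C act \<tau>" \<epsilon>C act fscale M actM ?\<rho>
    by (rule hopf)
  interpret D: module_coalgebra sH \<Delta>H \<epsilon>H sC "twist_comult sC \<Delta>C act \<tau>" \<epsilon>C act
    by (rule twisted)
  have \<rho>: "?\<rho> (\<iota> x c) = tlift fscale (\<lambda>c1 c2. tlift fscale (\<lambda>h d. actM (\<iota> x c1) h \<otimes>\<^bsub>fscale,sC\<^esub> d) (\<tau> c2)) (\<Delta>C c)"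
    for x c
  proof -
    have b: "bilinear_map fscale sC fscale (\<lambda>m0 m1. tlift fscale (\<lambda>h d. actM m0 h \<otimes>\<^bsub>fscale,sC\<^esub> d) (\<tau> m1))"
      by (intro lins)
    show ?thesis by (simp add: twist_coact_def coactM_\<iota> tlift_tlift tlift_tensor[OF b])
  qed
  have collapse_\<rho>: "tlift sX (\<lambda>m d. e (collapse m) d) (?\<rho> (\<iota> x c)) = tlift sX (\<lambda>h d. e (x * h) d) (\<tau> c)"
    if e: "bilinear_map sH sC sX e" for sX :: "'k \<Rightarrow> 'x::ab_group_add \<Rightarrow> 'x" and e x c
  proof -
    have [lins, simp]: "vector_space sX"
      using e by (auto simp: bilinear_map_def Vector_Spaces.linear_iff)
    note [lins] = bilinear_map_comp1[OF e] bilinear_map_comp2[OF e]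
    have b: "bilinear_map fscale sC sX (\<lambda>m d. e (collapse m) d)" by (intro lins)
    have s: "e (sH r x * h) d = sX r (e (x * h) d)" for r x h d
      by (rule lin_scaleD[where f = "\<lambda>x. e (x * h) d"]) (intro lins)
    have t: "tlift sX (\<lambda>h d. sX r (e (x * h) d)) u = sX r (tlift sX (\<lambda>h d. e (x * h) d) u)" for r x u
      by (rule tlift_lin[where f = "sX r", symmetric]) (rule lin_scale_right[OF lin_id], simp)
    have "tlift sX (\<lambda>m d. e (collapse m) d) (?\<rho> (\<iota> x c))
        = tlift sX (\<lambda>c1 c2. sX (\<epsilon>C c1) (tlift sX (\<lambda>h d. e (x * h) d) (\<tau> c2))) (\<Delta>C c)"
      unfolding \<rho> by (simp add: tlift_tlift tlift_tensor[OF b] collapse_actM collapse_\<iota> s t)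
    also have "\<dots> = tlift sX (\<lambda>h d. e (x * h) d) (\<tau> c)"
      by (rule C.counit_left_linear) (intro lins)
    finally show ?thesis .
  qed
  show "equivariant \<tau>"
    unfolding equivariant_def
  proof (intro allI)
    fix c h
    let ?e = "\<lambda>x d. tlift fscale (\<lambda>h1 h2. (x * h1) \<otimes>\<^bsub>sH,sC\<^esub> act d h2) (\<Delta>H h)"
    let ?Q = "tlift fscale (\<lambda>m d. collapse m \<otimes>\<^bsub>sH,sC\<^esub> d)"
    have b: "bilinear_map fscale sC fscale (\<lambda>m d. collapse m \<otimes>\<^bsub>sH,sC\<^esub> d)" by (intro lins)
    have "tlift fscale (\<lambda>x d. ?e x d) (\<tau> c) = tlift fscale (\<lambda>m d. ?e (collapse m) d) (?\<rho> (\<iota> 1 c))"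
      by (subst collapse_\<rho>) (intro lins, simp)
    also have "\<dots> = ?Q (?\<rho> (actM (\<iota> 1 c) h))"
      unfolding T.coact_act[OF \<iota>_in_M] by (simp add: tlift_tlift tlift_tensor[OF b] collapse_actM)
    also have "\<dots> = tlift fscale (\<lambda>h1 h2. ?Q (?\<rho> (\<iota> h1 (act c h2)))) (\<Delta>H h)"
      unfolding actM_\<iota> tlift_lin[OF T.coact_linear] by (simp add: tlift_tlift)
    also have "\<dots> = tlift fscale (\<lambda>h1 h2. tlift fscale (\<lambda>x d. (h1 * x) \<otimes>\<^bsub>sH,sC\<^esub> d) (\<tau> (act c h2))) (\<Delta>H h)"
      by (subst collapse_\<rho>) (intro lins refl)+
    finally show "tlift fscale (\<lambda>x d. ?e x d) (\<tau> c)
        = tlift fscale (\<lambda>h1 h2. tlift fscale (\<lambda>x d. (h1 * x) \<otimes>\<^bsub>sH,sC\<^esub> d) (\<tau> (act c h2))) (\<Delta>H h)" .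
  qed
  show "compatible \<tau>"
    unfolding compatible_def
  proof (intro allI)
    fix c
    let ?Q = "tlift fscale (\<lambda>m u. collapse m \<otimes>\<^bsub>sH,fscale\<^esub> u)"
    have b: "bilinear_map fscale fscale fscale (\<lambda>m u. collapse m \<otimes>\<^bsub>sH,fscale\<^esub> u)" by (intro lins)
    have b2: "bilinear_map fscale sC fscale (\<lambda>m0 m1. tlift fscale (\<lambda>m00 m01.
        collapse m00 \<otimes>\<^bsub>sH,fscale\<^esub> (m01 \<otimes>\<^bsub>sC,sC\<^esub> m1)) (?\<rho> m0))"
      by (intro lins lin_comp[OF T.coact_linear])
    have b3: "bilinear_map fscale sC fscale (\<lambda>m0 m1. collapse m0 \<otimes>\<^bsub>sH,fscale\<^esub> (m1 \<otimes>\<^bsub>sC,sC\<^esub> d))" for d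
      by (intro lins)
    have *: "tlift fscale (\<lambda>m00 m01. collapse m00 \<otimes>\<^bsub>sH,fscale\<^esub> (m01 \<otimes>\<^bsub>sC,sC\<^esub> d2)) (?\<rho> (actM (\<iota> 1 c) y))
        = tlift fscale (\<lambda>x d1. tlift fscale (\<lambda>y1 y2.
            (x * y1) \<otimes>\<^bsub>sH,fscale\<^esub> (act d1 y2 \<otimes>\<^bsub>sC,sC\<^esub> d2)) (\<Delta>H y)) (\<tau> c)" for c y d2
    proof -
      let ?e = "\<lambda>x d1. tlift fscale (\<lambda>y1 y2. (x * y1) \<otimes>\<^bsub>sH,fscale\<^esub> (act d1 y2 \<otimes>\<^bsub>sC,sC\<^esub> d2)) (\<Delta>H y)"
      have "tlift fscale (\<lambda>m00 m01. collapse m00 \<otimes>\<^bsub>sH,fscale\<^esub> (m01 \<otimes>\<^bsub>sC,sC\<^esub> d2)) (?\<rho> (actM (\<iota> 1 c) y))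
          = tlift fscale (\<lambda>m d. ?e (collapse m) d) (?\<rho> (\<iota> 1 c))"
        unfolding T.coact_act[OF \<iota>_in_M] by (simp add: tlift_tlift tlift_tensor[OF b3] collapse_actM)
      also have "\<dots> = tlift fscale (\<lambda>x d. ?e (1 * x) d) (\<tau> c)"
        by (rule collapse_\<rho>) (intro lins)
      finally show ?thesis by simp
    qed
    have "tlift fscale (\<lambda>x d. x \<otimes>\<^bsub>sH,fscale\<^esub> twist_comult sC \<Delta>C act \<tau> d) (\<tau> c)
        = tlift fscale (\<lambda>m d. collapse m \<otimes>\<^bsub>sH,fscale\<^esub> twist_comult sC \<Delta>C act \<tau> d) (?\<rho> (\<iota> 1 c))"
      by (subst collapse_\<rho>) (intro lins D.lin_comult, simp)
    also have "\<dots> = ?Q (tlift fscale (\<lambda>m0 m1. m0 \<otimes>\<^bsub>fscale,fscale\<^esub> twist_comult sC \<Delta>C act \<tau> m1) (?\<rho> (\<iota> 1 c)))"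
      by (simp add: tlift_tlift tlift_tensor[OF b])
    also have "\<dots> = tlift fscale (\<lambda>m0 m1. tlift fscale (\<lambda>m00 m01.
        collapse m00 \<otimes>\<^bsub>sH,fscale\<^esub> (m01 \<otimes>\<^bsub>sC,sC\<^esub> m1)) (?\<rho> m0)) (?\<rho> (\<iota> 1 c))"
      unfolding T.coact_coassoc[OF \<iota>_in_M, symmetric] by (simp add: tlift_tlift tlift_tensor[OF b])
    also have "\<dots> = tlift fscale (\<lambda>c1 c2. tlift fscale (\<lambda>y d2. tlift fscale (\<lambda>m00 m01.
        collapse m00 \<otimes>\<^bsub>sH,fscale\<^esub> (m01 \<otimes>\<^bsub>sC,sC\<^esub> d2)) (?\<rho> (actM (\<iota> 1 c1) y))) (\<tau> c2)) (\<Delta>C c)"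
      unfolding \<rho>[of 1 c] by (simp add: tlift_tlift tlift_tensor[OF b2])
    finally show "tlift fscale (\<lambda>x d. x \<otimes>\<^bsub>sH,fscale\<^esub> twist_comult sC \<Delta>C act \<tau> d) (\<tau> c)
     = tlift fscale (\<lambda>c1 c2. tlift fscale (\<lambda>y d2. tlift fscale (\<lambda>x d1. tlift fscale (\<lambda>y1 y2.
         (x * y1) \<otimes>\<^bsub>sH,fscale\<^esub> (act d1 y2 \<otimes>\<^bsub>sC,sC\<^esub> d2)) (\<Delta>H y)) (\<tau> c1)) (\<tau> c2)) (\<Delta>C c)"
      unfolding * .
  qed
qed

end

section \<open>Cotensor products and canonical maps\<close>

context hopf_module_coalgebra
begin

abbreviation \<pi> where "\<pi> \<equiv> proj_B \<epsilon>H sC act"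

lemma aug_sub_subspace: "C.subspace (aug_sub \<epsilon>H sC act)"
  unfolding aug_sub_def by (rule C.subspace_span)

lemma lin_proj [lins]: "lin s sC f \<Longrightarrow> lin s sC (\<lambda>x. \<pi> (f x))"
  unfolding proj_B_def by (rule lin_comp[OF quot_map_props(1)[OF C.vs_C aug_sub_subspace]])

lemma proj_act: "\<pi> (act c h) = sC (\<epsilon>H h) (\<pi> c)"
proof -
  interpret A: Vector_Spaces.linear sH sC "act c" using C.lin_act2[OF lin_id[OF H.vs_C]] .
  interpret E: Vector_Spaces.linear sH "(*)" \<epsilon>H by (rule H.counit_linear)
  interpret P: Vector_Spaces.linear sC sC \<pi> using lin_proj[OF lin_id[OF C.vs_C]] .
  have "\<epsilon>H (h - sH (\<epsilon>H h) 1) = 0" by (simp add: E.diff E.scale H.counit_one)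
  then have "act c (h - sH (\<epsilon>H h) 1) \<in> {act d h |d h. \<epsilon>H h = 0}"
    by blast
  then have "act c (h - sH (\<epsilon>H h) 1) \<in> aug_sub \<epsilon>H sC act"
    unfolding aug_sub_def by (rule C.span_base)
  then have "\<pi> (act c (h - sH (\<epsilon>H h) 1)) = 0"
    unfolding proj_B_def using quot_map_props(3)[OF C.vs_C aug_sub_subspace] by blast
  then show ?thesis by (simp add: A.diff A.scale P.diff P.scale)
qed

abbreviation cotensor_B where
  "cotensor_B \<equiv> cotensor sC sC sC (right_B_coact \<epsilon>H sC \<Delta>C act) (left_B_coact \<epsilon>H sC \<Delta>C act)"

lemma lin_right_B_coact [lins]: "lin s sC f \<Longrightarrow> lin s fscale (\<lambda>x. right_B_coact \<epsilon>H sC \<Delta>C act (f x))"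
  unfolding right_B_coact_def by (intro lins)

lemma lin_left_B_coact [lins]: "lin s sC f \<Longrightarrow> lin s fscale (\<lambda>x. left_B_coact \<epsilon>H sC \<Delta>C act (f x))"
  unfolding left_B_coact_def by (intro lins)

lemma canonical_map'_in: "canonical_map' t \<in> TS sC sC"
  unfolding canonical_map'_def
  by (rule tlift_in_subspace, simp, simp, rule tlift_in_subspace) simp_all

lemma bij_betw_canonical_map_iff:
  "bij_betw (canonical_map sC \<Delta>C act) (TS sC sH) U \<longleftrightarrow> bij_betw canonical_map' (TS sC sH) U"
  by (subst bij_betw_comp_iff[OF bij_betw_shear])
    (rule bij_betw_cong, simp add: canonical_map_shear)

end

locale invertible_twist = hopf_module_coalgebra sH \<Delta>H \<epsilon>H S sC \<Delta>C \<epsilon>C act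
  for sH :: "'k::field \<Rightarrow> 'h::ring_1 \<Rightarrow> 'h"
    and \<Delta>H :: "'h \<Rightarrow> ('h \<times> 'h \<Rightarrow>\<^sub>0 'k)" and \<epsilon>H :: "'h \<Rightarrow> 'k" and S :: "'h \<Rightarrow> 'h"
    and sC :: "'k \<Rightarrow> 'c::ab_group_add \<Rightarrow> 'c"
    and \<Delta>C :: "'c \<Rightarrow> ('c \<times> 'c \<Rightarrow>\<^sub>0 'k)" and \<epsilon>C :: "'c \<Rightarrow> 'k" and act :: "'c \<Rightarrow> 'h \<Rightarrow> 'c" +
  fixes \<tau> \<upsilon> :: "'c \<Rightarrow> ('h \<times> 'c \<Rightarrow>\<^sub>0 'k)"
  assumes tau_linear: "lin sC fscale \<tau>" and ups_linear: "lin sC fscale \<upsilon>"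
    and conv_tau_ups: "conv sH sC \<tau> \<upsilon> = conv_unit sH sC"
    and conv_ups_tau: "conv sH sC \<upsilon> \<tau> = conv_unit sH sC"
    and normalized_tau: "normalized sH \<epsilon>H sC \<epsilon>C \<tau>"
    and equivariant_tau: "equivariant \<tau>" and compatible_tau: "compatible \<tau>"
    and twisted: "module_coalgebra sH \<Delta>H \<epsilon>H sC (twist_comult sC \<Delta>C act \<tau>) \<epsilon>C act"
begin

abbreviation \<Delta>\<tau> where "\<Delta>\<tau> \<equiv> twist_comult sC \<Delta>C act \<tau>"

sublocale D: hopf_module_coalgebra sH \<Delta>H \<epsilon>H S sC \<Delta>\<tau> \<epsilon>C act
  unfolding hopf_module_coalgebra_def using H.bijective_antipode_axioms twisted by blast

lemmas equivariant_ups =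
  equivariant_inverse[OF tau_linear ups_linear conv_tau_ups conv_ups_tau equivariant_tau]

abbreviation g where "g \<equiv> untwist \<tau>"
abbreviation g' where "g' \<equiv> untwist \<upsilon>"

lemma untwist_untwist [simp]: "g' (g c) = c" "g (g' c) = c"
  using untwist_inverse[OF tau_linear ups_linear conv_tau_ups equivariant_ups]
    untwist_inverse[OF ups_linear tau_linear conv_ups_tau equivariant_tau] .

lemmas lin_g [lins] = lin_untwist[OF tau_linear] lin_untwist[OF ups_linear]

lemma twist_comult_bilinear:
  assumes e: "bilinear_map sC sC sX e"
  shows "tlift sX e (\<Delta>\<tau> c) = tlift sX (\<lambda>c1 c2. tlift sX (\<lambda>x d. e (act c1 x) d) (\<tau> c2)) (\<Delta>C c)"
proof -
  have "vector_space sX"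
    using e by (auto simp: bilinear_map_def Vector_Spaces.linear_iff)
  then show ?thesis
    by (simp add: twist_comult_def twist_coact_def tlift_tlift tlift_tensor[OF e])
qed

text \<open>
  In \<open>\<Delta>\<^sub>\<tau>(c\<^sub>0 \<cdot> S\<^sup>-\<^sup>1(c\<^sub>-\<^sub>1))\<close> the projection \<open>\<pi>\<close> absorbs the second leg of \<open>S\<^sup>-\<^sup>1(c\<^sub>-\<^sub>1)\<close>. What is left is
  the expression of \<open>untwist_comult\<close>.
\<close>
lemma right_B_coact_untwist:
  "right_B_coact \<epsilon>H sC \<Delta>\<tau> act (g c) = tlift fscale (\<lambda>c1 c2. g c1 \<otimes>\<^bsub>sC,sC\<^esub> \<pi> c2) (\<Delta>C c)"
proof -
  have "right_B_coact \<epsilon>H sC \<Delta>\<tau> act (g c)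
      = tlift fscale (\<lambda>x d. right_B_coact \<epsilon>H sC \<Delta>\<tau> act (act d (S' x))) (\<tau> c)"
    unfolding untwist_def by (rule tlift_lin[OF D.lin_right_B_coact[OF lin_id[OF C.vs_C]]])
  also have "\<dots> = tlift fscale (\<lambda>x d. tlift fscale (\<lambda>d1 d2. tlift fscale (\<lambda>k1 k2.
      act d1 k1 \<otimes>\<^bsub>sC,sC\<^esub> \<pi> (act d2 k2)) (\<Delta>H (S' x))) (\<Delta>\<tau> d)) (\<tau> c)"
    unfolding right_B_coact_def by (subst D.C.comult_act_bilinear) (intro lins refl)+
  also have "\<dots> = tlift fscale (\<lambda>x d. tlift fscale (\<lambda>d1 d2. tlift fscale (\<lambda>k1 k2.
      fscale (\<epsilon>H k2) (act d1 k1 \<otimes>\<^bsub>sC,sC\<^esub> \<pi> d2)) (\<Delta>H (S' x))) (\<Delta>\<tau> d)) (\<tau> c)"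
  proof -
    have "c \<otimes>\<^bsub>sC,sC\<^esub> sC r d = fscale r (c \<otimes>\<^bsub>sC,sC\<^esub> d)" for c d r
      by (rule lin_scaleD[where f = "\<lambda>x. c \<otimes>\<^bsub>sC,sC\<^esub> x"]) (intro lins)
    then show ?thesis by (simp add: proj_act)
  qed
  also have "\<dots> = tlift fscale (\<lambda>x d. tlift fscale (\<lambda>d1 d2. act d1 (S' x) \<otimes>\<^bsub>sC,sC\<^esub> \<pi> d2) (\<Delta>\<tau> d)) (\<tau> c)"
    by (subst H.counit_right_linear) (intro lins refl)+
  also have "\<dots> = tlift fscale (\<lambda>c1 c2. g c1 \<otimes>\<^bsub>sC,sC\<^esub> \<pi> c2) (\<Delta>C c)"
    by (rule untwist_comult[OF tau_linear compatible_tau normalized_tau]) (intro lins)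
  finally show ?thesis .
qed

lemma left_B_coact_twist: "left_B_coact \<epsilon>H sC \<Delta>\<tau> act c = left_B_coact \<epsilon>H sC \<Delta>C act c"
proof -
  have "left_B_coact \<epsilon>H sC \<Delta>\<tau> act c
      = tlift fscale (\<lambda>c1 c2. tlift fscale (\<lambda>x d. fscale (\<epsilon>H x) (\<pi> c1 \<otimes>\<^bsub>sC,sC\<^esub> d)) (\<tau> c2)) (\<Delta>C c)"
  proof -
    have "tensor (sC r c) sC sC = (\<lambda>d. fscale r (c \<otimes>\<^bsub>sC,sC\<^esub> d))" for r c
      by (rule ext) (simp add: tensor_scale)
    then show ?thesis
      unfolding left_B_coact_def
      by (subst twist_comult_bilinear) (intro lins, simp add: proj_act)
  qed
  also have "\<dots> = left_B_coact \<epsilon>H sC \<Delta>C act c"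
    unfolding left_B_coact_def
    by (subst normalized_counit_H[OF normalized_tau]) (intro lins refl)+
  finally show ?thesis .
qed

text \<open>
  The map \<open>g \<otimes> id\<close> on \<open>C \<otimes> C\<close>.
\<close>
definition untwist_left :: "('c \<times> 'c \<Rightarrow>\<^sub>0 'k) \<Rightarrow> ('c \<times> 'c \<Rightarrow>\<^sub>0 'k)" where
  "untwist_left = tlift fscale (\<lambda>a b. g a \<otimes>\<^bsub>sC,sC\<^esub> b)"

lemma untwist_left_tensor: "untwist_left (a \<otimes>\<^bsub>sC,sC\<^esub> b) = g a \<otimes>\<^bsub>sC,sC\<^esub> b"
  unfolding untwist_left_def by (rule tlift_tensor) (intro lins)

lemma bij_betw_untwist_left: "bij_betw untwist_left (TS sC sC) (TS sC sC)"
proof (rule bij_betw_tensor_spaceI)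
  let ?G' = "tlift fscale (\<lambda>a b. g' a \<otimes>\<^bsub>sC,sC\<^esub> b)"
  show "lin fscale fscale untwist_left" "lin fscale fscale ?G'"
    unfolding untwist_left_def by (rule linear_tlift, simp)+
  have G': "?G' (a \<otimes>\<^bsub>sC,sC\<^esub> b) = g' a \<otimes>\<^bsub>sC,sC\<^esub> b" for a b
    by (rule tlift_tensor) (intro lins)
  fix a b
  show "untwist_left (a \<otimes>\<^bsub>sC,sC\<^esub> b) \<in> TS sC sC" "?G' (a \<otimes>\<^bsub>sC,sC\<^esub> b) \<in> TS sC sC"
    "?G' (untwist_left (a \<otimes>\<^bsub>sC,sC\<^esub> b)) = a \<otimes>\<^bsub>sC,sC\<^esub> b" "untwist_left (?G' (a \<otimes>\<^bsub>sC,sC\<^esub> b)) = a \<otimes>\<^bsub>sC,sC\<^esub> b"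
    by (simp_all add: untwist_left_tensor G')
qed

text \<open>
  The two maps \<open>C \<otimes> C \<rightarrow> C \<otimes> B \<otimes> C\<close> whose equalizer is the cotensor product of \<open>C\<close> correspond to those of
  \<open>C\<^sup>\<tau>\<close> under \<open>g \<otimes> id\<close> on the source and \<open>g \<otimes> id \<otimes> id\<close>, which is injective, on the target.
\<close>
lemma untwist_left_cotensor_iff:
  assumes t: "t \<in> TS sC sC"
  shows "untwist_left t \<in> D.cotensor_B \<longleftrightarrow> t \<in> cotensor_B"
proof -
  define l where "l \<rho> = tlift fscale (\<lambda>x y. tlift fscale (\<lambda>x0 b. x0 \<otimes>\<^bsub>sC,fscale\<^esub> (b \<otimes>\<^bsub>sC,sC\<^esub> y)) (\<rho> x))"
    for \<rho> :: "'c \<Rightarrow> ('c \<times> 'c \<Rightarrow>\<^sub>0 'k)"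
  define r where "r \<mu> = tlift fscale (\<lambda>x y. x \<otimes>\<^bsub>sC,fscale\<^esub> \<mu> y)"
    for \<mu> :: "'c \<Rightarrow> ('c \<times> 'c \<Rightarrow>\<^sub>0 'k)"
  define G3 where "G3 f = tlift fscale (\<lambda>a (u :: 'c \<times> 'c \<Rightarrow>\<^sub>0 'k). f a \<otimes>\<^bsub>sC,fscale\<^esub> u)"
    for f :: "'c \<Rightarrow> 'c"
  let ?\<rho> = "right_B_coact \<epsilon>H sC \<Delta>C act" and ?\<mu> = "left_B_coact \<epsilon>H sC \<Delta>C act"
  let ?\<rho>\<tau> = "right_B_coact \<epsilon>H sC \<Delta>\<tau> act" and ?\<mu>\<tau> = "left_B_coact \<epsilon>H sC \<Delta>\<tau> act"
  have linG: "lin fscale fscale untwist_left" and linl: "lin fscale fscale (l \<rho>)"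
    and linr: "lin fscale fscale (r \<mu>)" and lin3: "lin fscale fscale (G3 f)" for \<rho> \<mu> f
    unfolding untwist_left_def l_def r_def G3_def by (rule linear_tlift, simp)+
  have in3: "l \<rho> t \<in> TS sC fscale" "r \<mu> t \<in> TS sC fscale" for \<rho> \<mu>
    unfolding l_def r_def
    by (rule tlift_in_subspace, simp, simp, (rule tlift_in_subspace)?, simp_all)+
  have b: "bilinear_map sC sC fscale (\<lambda>x0 b. x0 \<otimes>\<^bsub>sC,fscale\<^esub> (b \<otimes>\<^bsub>sC,sC\<^esub> y))" for y
    by (intro lins)
  have G3: "G3 g (a \<otimes>\<^bsub>sC,fscale\<^esub> u) = g a \<otimes>\<^bsub>sC,fscale\<^esub> u"
    "G3 g' (a \<otimes>\<^bsub>sC,fscale\<^esub> u) = g' a \<otimes>\<^bsub>sC,fscale\<^esub> u" for a u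
    unfolding G3_def by (rule tlift_tensor, intro lins)+
  have inv: "G3 g' (G3 g u) = u" if "u \<in> TS sC fscale" for u
    by (rule tensor_space_eqI[OF that lin_comp[OF lin3 lin3] lin_id[OF vs_fscale]])
      (simp add: G3)
  have lt: "l \<rho> (x \<otimes>\<^bsub>sC,sC\<^esub> y) = tlift fscale (\<lambda>x0 b. x0 \<otimes>\<^bsub>sC,fscale\<^esub> (b \<otimes>\<^bsub>sC,sC\<^esub> y)) (\<rho> x)"
    if "lin sC fscale \<rho>" for \<rho> x y
    unfolding l_def by (rule tlift_tensor) (intro lins lin_comp[OF that])
  have rt: "r \<mu> (x \<otimes>\<^bsub>sC,sC\<^esub> y) = x \<otimes>\<^bsub>sC,fscale\<^esub> \<mu> y"
    if "lin sC fscale \<mu>" for \<mu> x y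
    unfolding r_def by (rule tlift_tensor) (intro lins lin_comp[OF that])
  have lin\<rho>: "lin sC fscale ?\<rho>" "lin sC fscale ?\<rho>\<tau>" "lin sC fscale ?\<mu>" "lin sC fscale ?\<mu>\<tau>"
    by (rule lin_right_B_coact D.lin_right_B_coact lin_left_B_coact D.lin_left_B_coact, rule lin_id, simp)+
  have L: "l ?\<rho>\<tau> (untwist_left t) = G3 g (l ?\<rho> t)"
  proof (rule tensor_space_eqI[OF t lin_comp[OF linl linG] lin_comp[OF lin3 linl]])
    fix x y
    have "l ?\<rho>\<tau> (untwist_left (x \<otimes>\<^bsub>sC,sC\<^esub> y))
        = tlift fscale (\<lambda>c1 c2. g c1 \<otimes>\<^bsub>sC,fscale\<^esub> (\<pi> c2 \<otimes>\<^bsub>sC,sC\<^esub> y)) (\<Delta>C x)"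
      by (simp add: untwist_left_tensor lt lin\<rho> right_B_coact_untwist tlift_tlift tlift_tensor[OF b])
    also have "\<dots> = G3 g (l ?\<rho> (x \<otimes>\<^bsub>sC,sC\<^esub> y))"
      by (simp add: lt lin\<rho> right_B_coact_def tlift_tlift tlift_tensor[OF b] tlift_lin[OF lin3] G3)
    finally show "l ?\<rho>\<tau> (untwist_left (x \<otimes>\<^bsub>sC,sC\<^esub> y)) = G3 g (l ?\<rho> (x \<otimes>\<^bsub>sC,sC\<^esub> y))" .
  qed
  have R: "r ?\<mu>\<tau> (untwist_left t) = G3 g (r ?\<mu> t)"
    by (rule tensor_space_eqI[OF t lin_comp[OF linr linG] lin_comp[OF lin3 linr]])
      (simp add: untwist_left_tensor rt lin\<rho> left_B_coact_twist G3)
  have "untwist_left t \<in> TS sC sC" using bij_betw_untwist_left t by (auto simp: bij_betw_def)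
  then have "untwist_left t \<in> D.cotensor_B \<longleftrightarrow> l ?\<rho>\<tau> (untwist_left t) = r ?\<mu>\<tau> (untwist_left t)"
    by (simp add: cotensor_def l_def r_def)
  also have "\<dots> \<longleftrightarrow> l ?\<rho> t = r ?\<mu> t"
    unfolding L R using inv[OF in3(1)] inv[OF in3(2)] by metis
  also have "\<dots> \<longleftrightarrow> t \<in> cotensor_B"
    using t by (simp add: cotensor_def l_def r_def)
  finally show ?thesis .
qed

text \<open>
  The map \<open>c \<otimes> h \<mapsto> c\<^sub>0 \<otimes> S\<^sup>-\<^sup>1(c\<^sub>-\<^sub>1) h\<close>, a lift of the untwisting map along the action
  \<open>C \<otimes> H \<rightarrow> C\<close>. It corresponds to \<open>g \<otimes> id\<close> on the domains of the canonical maps.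
\<close>
definition translate :: "('c \<Rightarrow> ('h \<times> 'c \<Rightarrow>\<^sub>0 'k)) \<Rightarrow> ('c \<times> 'h \<Rightarrow>\<^sub>0 'k) \<Rightarrow> ('c \<times> 'h \<Rightarrow>\<^sub>0 'k)" where
  "translate \<sigma> = tlift fscale (\<lambda>c h. tlift fscale (\<lambda>x d. d \<otimes>\<^bsub>sC,sH\<^esub> (S' x * h)) (\<sigma> c))"

lemma translate_tensor:
  assumes "lin sC fscale \<sigma>"
  shows "translate \<sigma> (c \<otimes>\<^bsub>sC,sH\<^esub> h) = tlift fscale (\<lambda>x d. d \<otimes>\<^bsub>sC,sH\<^esub> (S' x * h)) (\<sigma> c)"
  unfolding translate_def by (rule tlift_tensor) (intro lins lin_comp[OF assms])

lemma linear_translate: "lin fscale fscale (translate \<sigma>)"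
  unfolding translate_def by (rule linear_tlift) simp

lemma translate_translate:
  assumes lin: "lin sC fscale \<sigma>" "lin sC fscale \<sigma>'" and conv: "conv sH sC \<sigma> \<sigma>' = conv_unit sH sC"
  shows "translate \<sigma>' (translate \<sigma> (c \<otimes>\<^bsub>sC,sH\<^esub> h)) = c \<otimes>\<^bsub>sC,sH\<^esub> h"
proof -
  have "translate \<sigma>' (translate \<sigma> (c \<otimes>\<^bsub>sC,sH\<^esub> h))
      = tlift fscale (\<lambda>x d. tlift fscale (\<lambda>y d'. d' \<otimes>\<^bsub>sC,sH\<^esub> (S' (x * y) * h)) (\<sigma>' d)) (\<sigma> c)"
    by (simp add: translate_tensor lin tlift_lin[OF linear_translate] H.antipode_inv_mult mult.assoc)
  also have "\<dots> = c \<otimes>\<^bsub>sC,sH\<^esub> (S' 1 * h)"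
    by (rule conv_unit_bilinear[OF conv]) (intro lins)
  finally show ?thesis by (simp add: H.antipode_inv_one)
qed

lemma bij_betw_translate: "bij_betw (translate \<tau>) (TS sC sH) (TS sC sH)"
proof (rule bij_betw_tensor_spaceI[OF linear_translate linear_translate[of \<upsilon>]])
  show "translate \<tau> (c \<otimes>\<^bsub>sC,sH\<^esub> h) \<in> TS sC sH" "translate \<upsilon> (c \<otimes>\<^bsub>sC,sH\<^esub> h) \<in> TS sC sH" for c h
    unfolding translate_tensor[OF tau_linear] translate_tensor[OF ups_linear]
    by (rule tlift_in_subspace, simp_all)+
qed (rule translate_translate[OF tau_linear ups_linear conv_tau_ups] translate_translate[OF ups_linear tau_linear conv_ups_tau])+

text \<open>
  Both sides send \<open>c \<otimes> h\<close> to \<open>g(c\<^sub>1) \<cdot> h \<otimes> c\<^sub>2\<close>: the left one because \<open>g\<close> is \<open>H\<close>-linear, the right one by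
  \<open>untwist_comult\<close>.
\<close>
lemma untwist_left_canonical_map':
  assumes "t \<in> TS sC sH"
  shows "untwist_left (canonical_map' t) = D.canonical_map' (translate \<tau> t)"
proof -
  have linG: "lin fscale fscale untwist_left" unfolding untwist_left_def by (rule linear_tlift) simp
  have linK: "lin fscale fscale canonical_map'" "lin fscale fscale D.canonical_map'"
    unfolding canonical_map'_def D.canonical_map'_def by (rule linear_tlift, simp)+
  show ?thesis
  proof (rule tensor_space_eqI[OF assms lin_comp[OF linG linK(1)] lin_comp[OF linK(2) linear_translate]])
    fix c h
    have "untwist_left (canonical_map' (c \<otimes>\<^bsub>sC,sH\<^esub> h)) = tlift fscale (\<lambda>c1 c2. act (g c1) h \<otimes>\<^bsub>sC,sC\<^esub> c2) (\<Delta>C c)"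
      by (simp add: canonical_map'_tensor tlift_lin[OF linG] untwist_left_tensor
          untwist_act[OF tau_linear equivariant_tau])
    also have "\<dots> = tlift fscale (\<lambda>x d. tlift fscale (\<lambda>d1 d2.
        act (act d1 (S' x)) h \<otimes>\<^bsub>sC,sC\<^esub> d2) (\<Delta>\<tau> d)) (\<tau> c)"
      by (rule untwist_comult[OF tau_linear compatible_tau normalized_tau, symmetric]) (intro lins)
    also have "\<dots> = D.canonical_map' (translate \<tau> (c \<otimes>\<^bsub>sC,sH\<^esub> h))"
      by (simp add: translate_tensor[OF tau_linear] tlift_lin[OF linK(2)] D.canonical_map'_tensor)
    finally show "untwist_left (canonical_map' (c \<otimes>\<^bsub>sC,sH\<^esub> h)) = D.canonical_map' (translate \<tau> (c \<otimes>\<^bsub>sC,sH\<^esub> h))" .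
  qed
qed

lemma galois_twist_iff:
  "galois_coextension sH \<Delta>H \<epsilon>H sC \<Delta>\<tau> \<epsilon>C act \<longleftrightarrow> galois_coextension sH \<Delta>H \<epsilon>H sC \<Delta>C \<epsilon>C act"
proof -
  let ?W = "TS sC sH"
  have inj: "inj_on untwist_left (TS sC sC)" and untwist_left_image: "untwist_left ` TS sC sC = TS sC sC"
    using bij_betw_untwist_left by (auto simp: bij_betw_def)
  have sub: "cotensor_B \<subseteq> TS sC sC" "D.cotensor_B \<subseteq> TS sC sC" "canonical_map' ` ?W \<subseteq> TS sC sC"
    using canonical_map'_in by (simp_all add: cotensor_def image_subset_iff Collect_restrict)
  have "untwist_left ` cotensor_B = D.cotensor_B"
  proof (intro equalityI subsetI)
    fix u assume "u \<in> untwist_left ` cotensor_B"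
    then obtain t where "t \<in> cotensor_B" "u = untwist_left t" by (rule imageE)
    then show "u \<in> D.cotensor_B" using sub(1) untwist_left_cotensor_iff[of t] by (simp add: subset_iff)
  next
    fix u assume u: "u \<in> D.cotensor_B"
    then have "u \<in> untwist_left ` TS sC sC" using sub(2) untwist_left_image by (simp add: subset_iff)
    then obtain t where "t \<in> TS sC sC" "u = untwist_left t" by (rule imageE)
    then show "u \<in> untwist_left ` cotensor_B" using u untwist_left_cotensor_iff[of t] by simp
  qed
  then have "(untwist_left \<circ> canonical_map') ` ?W = D.cotensor_B \<longleftrightarrow> canonical_map' ` ?W = cotensor_B"
    using inj_on_image_eq_iff[OF inj sub(3,1)] by (simp only: image_comp[symmetric])
  moreover have "inj_on (untwist_left \<circ> canonical_map') ?W \<longleftrightarrow> inj_on canonical_map' ?W"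
    using inj_on_imageI2 comp_inj_on[OF _ inj_on_subset[OF inj sub(3)]] by metis
  ultimately have "bij_betw (untwist_left \<circ> canonical_map') ?W D.cotensor_B \<longleftrightarrow> bij_betw canonical_map' ?W cotensor_B"
    by (simp only: bij_betw_def)
  moreover have "bij_betw D.canonical_map' ?W D.cotensor_B
      \<longleftrightarrow> bij_betw (untwist_left \<circ> canonical_map') ?W D.cotensor_B"
    by (subst bij_betw_comp_iff[OF bij_betw_translate]) (rule bij_betw_cong, simp add: untwist_left_canonical_map')
  ultimately show ?thesis
    by (simp add: galois_coextension_def bij_betw_canonical_map_iff D.bij_betw_canonical_map_iff
        C.module_coalgebra_axioms D.C.module_coalgebra_axioms)
qed

end

theorem theorem4p2:
  fixes sH :: "'k::field \<Rightarrow> 'h::ring_1 \<Rightarrow> 'h"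
    and \<Delta>H :: "'h \<Rightarrow> ('h \<times> 'h \<Rightarrow>\<^sub>0 'k)" and \<epsilon>H :: "'h \<Rightarrow> 'k" and S :: "'h \<Rightarrow> 'h"
    and sC :: "'k \<Rightarrow> 'c::ab_group_add \<Rightarrow> 'c"
    and \<Delta>C :: "'c \<Rightarrow> ('c \<times> 'c \<Rightarrow>\<^sub>0 'k)" and \<epsilon>C :: "'c \<Rightarrow> 'k" and actC :: "'c \<Rightarrow> 'h \<Rightarrow> 'c"
    and \<tau> :: "'c \<Rightarrow> ('h \<times> 'c \<Rightarrow>\<^sub>0 'k)"
  assumes "hopf_algebra sH \<Delta>H \<epsilon>H S" and "bij S"
    and "module_coalgebra sH \<Delta>H \<epsilon>H sC \<Delta>C \<epsilon>C actC"
    and "twisting sH \<Delta>H \<epsilon>H sC \<Delta>C \<epsilon>C actC \<tau>"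
    and "conv_invertible sH sC \<tau>"
  shows "galois_coextension sH \<Delta>H \<epsilon>H sC (twist_comult sC \<Delta>C actC \<tau>) \<epsilon>C actC
     \<longleftrightarrow> galois_coextension sH \<Delta>H \<epsilon>H sC \<Delta>C \<epsilon>C actC"
proof -
  have \<tau>: "\<tau> \<in> Hom_HC sH sC" "normalized sH \<epsilon>H sC \<epsilon>C \<tau>"
    "module_coalgebra sH \<Delta>H \<epsilon>H sC (twist_comult sC \<Delta>C actC \<tau>) \<epsilon>C actC"
    using assms(4) by (simp_all add: twisting_def)
  obtain \<upsilon> where \<upsilon>: "\<upsilon> \<in> Hom_HC sH sC" "conv sH sC \<tau> \<upsilon> = conv_unit sH sC"
    "conv sH sC \<upsilon> \<tau> = conv_unit sH sC"
    using assms(5) unfolding conv_invertible_def by blast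
  have lin: "lin sC fscale \<tau>" "lin sC fscale \<upsilon>"
    using \<tau>(1) \<upsilon>(1) by (simp_all add: Hom_HC_def)
  interpret hopf_module_coalgebra sH \<Delta>H \<epsilon>H S sC \<Delta>C \<epsilon>C actC
    by (intro hopf_module_coalgebra.intro bijective_antipode.intro bijective_antipode_axioms.intro
        assms)
  have M: "hopf_module sH \<Delta>H sC (twist_comult sC \<Delta>C actC \<tau>) \<epsilon>C actC fscale M actM
      (twist_coact sC \<tau> fscale actM coactM)"
    using assms(4) hopf_module_M unfolding twisting_def by blast
  note eq = twisted_hopf_module_equivariant[OF lin(1) M \<tau>(3)]
    and comp = twisted_hopf_module_compatible[OF lin(1) M \<tau>(3)]
  interpret invertible_twist sH \<Delta>H \<epsilon>H S sC \<Delta>C \<epsilon>C actC \<tau> \<upsilon>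
    by (rule invertible_twist.intro[OF hopf_module_coalgebra_axioms invertible_twist_axioms.intro])
      (fact lin \<tau> \<upsilon> eq comp)+
  show ?thesis by (rule galois_twist_iff)
qed

end
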